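(* Let $k\ge 1$ be an integer and let $G$ be an $(a,b)$-biregular bipartite graph with $a\ge 6k$ and $b\ge 6k$. Let $\lambda_2$ be the second largest eigenvalue of the adjacency matrix of $G$. If $$\lambda_2\le \sqrt{ab} -\frac{3k+\max\{a,b\}}{\sqrt{\left\lceil\frac{a-1}{2}\right\rceil\left\lceil\frac{b-1}{2}\right\rceil}},$$ then $G$ has at least $k$ pairwise edge-disjoint spanning $2$-connected subgraphs.
   Context: All graphs are finite and simple. A bipartite graph with bipartition $(X,Y)$ ($X,Y$ nonempty) is $(a,b)$-biregular ($a,b$ positive integers) if every vertex of $X$ has degree $a$ and every vertex of $Y$ has degree $b$; it is not assumed connected. The eigenvalues of the adjacency matrix of $G$ on $n$ vertices are ordered $\lambda_1\ge\lambda_2\ge\cdots\ge\lambda_n$, counted with multiplicity. A graph is $2$-connected if its vertex connectivity (the minimum number of vertices whose removal produces a disconnected graph) is at least $2$. *)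

theory Defs
  imports "Graph_Theory.Digraph_Component" "Jordan_Normal_Form.Char_Poly"
begin

text \<open>
  A finite simple graph is a \<open>pair_graph\<close> of the Graph Theory library: a finite vertex set
  \<open>pverts G\<close> and a symmetric, irreflexive set \<open>parcs G\<close> of ordered pairs of vertices. An edge
  \<open>uv\<close> is thus represented by the two arcs \<open>(u, v)\<close> and \<open>(v, u)\<close>, and the degree of a vertex
  is its \<open>out_degree\<close>.
\<close>

definition bipartition :: "'a pair_pre_digraph \<Rightarrow> 'a set \<Rightarrow> 'a set \<Rightarrow> bool" where
  "bipartition G X Y \<longleftrightarrow>
     X \<noteq> {} \<and> Y \<noteq> {} \<and> X \<inter> Y = {} \<and> X \<union> Y = pverts G \<and> parcs G \<subseteq> X \<times> Y \<union> Y \<times> X"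

definition biregular_bipartite :: "nat \<Rightarrow> nat \<Rightarrow> 'a pair_pre_digraph \<Rightarrow> bool" where
  "biregular_bipartite a b G \<longleftrightarrow> a > 0 \<and> b > 0 \<and>
     (\<exists>X Y. bipartition G X Y \<and>
        (\<forall>x\<in>X. out_degree (with_proj G) x = a) \<and> (\<forall>y\<in>Y. out_degree (with_proj G) y = b))"

definition adjacency_matrix :: "'a pair_pre_digraph \<Rightarrow> 'a list \<Rightarrow> real mat" where
  "adjacency_matrix G vs =
     mat (length vs) (length vs) (\<lambda>(i, j). if (vs ! i, vs ! j) \<in> parcs G then 1 else 0)"

text \<open>
  The characteristic polynomial does not depend on how the vertices are enumerated, so an
  arbitrary enumeration may be chosen below.
\<close>

lemma char_poly_adjacency_matrix_cong:
  assumes "distinct vs" "distinct ws" "set vs = set ws"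
  shows "char_poly (adjacency_matrix G vs) = char_poly (adjacency_matrix G ws)"
proof -
  define n where "n = length vs"
  have n: "length ws = n"
    using assms by (metis distinct_card n_def)
  define P :: "real mat" where "P = mat n n (\<lambda>(i, j). if vs ! i = ws ! j then 1 else 0)"
  define Q :: "real mat" where "Q = mat n n (\<lambda>(i, j). if ws ! i = vs ! j then 1 else 0)"
  have exw: "\<exists>!j. j < n \<and> ws ! j = vs ! i" if "i < n" for i
    using that assms n by (metis distinct_Ex1 n_def nth_mem)
  have exv: "\<exists>!j. j < n \<and> vs ! j = ws ! i" if "i < n" for i
    using that assms n by (metis distinct_Ex1 n_def nth_mem)
  define p where "p i = (THE j. j < n \<and> ws ! j = vs ! i)" for i
  define q where "q i = (THE j. j < n \<and> vs ! j = ws ! i)" for i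
  have p: "p i < n" "ws ! p i = vs ! i" if "i < n" for i
    using theI'[OF exw[OF that]] by (auto simp: p_def)
  have q: "q i < n" "vs ! q i = ws ! i" if "i < n" for i
    using theI'[OF exv[OF that]] by (auto simp: q_def)
  have pi: "(vs ! i = ws ! j) \<longleftrightarrow> j = p i" if "i < n" "j < n" for i j
    using exw[OF that(1)] p[OF that(1)] that(2) by metis
  have pj: "(vs ! i = ws ! j) \<longleftrightarrow> i = q j" if "i < n" "j < n" for i j
    using exv[OF that(2)] q[OF that(2)] that(1) by metis
  have vinj: "vs ! i = vs ! j \<longleftrightarrow> i = j" if "i < n" "j < n" for i j
    using that assms(1) n_def nth_eq_iff_index_eq by blast
  have winj: "ws ! i = ws ! j \<longleftrightarrow> i = j" if "i < n" "j < n" for i j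
    using that assms(2) n nth_eq_iff_index_eq by blast
  have PQ: "P * Q = 1\<^sub>m n"
  proof (rule eq_matI)
    fix i j assume "i < dim_row (1\<^sub>m n)" "j < dim_col (1\<^sub>m n)"
    then have ij: "i < n" "j < n" by auto
    have "(P * Q) $$ (i, j) =
        (\<Sum>k\<in>{0..<n}. (if vs ! i = ws ! k then 1 else 0) * (if ws ! k = vs ! j then 1 else 0))"
      using ij by (simp add: P_def Q_def scalar_prod_def)
    also have "\<dots> = (\<Sum>k\<in>{0..<n}. if k = p i then (if ws ! p i = vs ! j then 1 else 0) else 0)"
      using ij pi by (intro sum.cong) auto
    also have "\<dots> = (if i = j then 1 else 0)"
      using ij p vinj by simp
    finally show "(P * Q) $$ (i, j) = 1\<^sub>m n $$ (i, j)" using ij by simp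
  qed (auto simp: P_def Q_def)
  have QP: "Q * P = 1\<^sub>m n"
    using PQ by (rule mat_mult_left_right_inverse[rotated 2]) (auto simp: P_def Q_def)
  have AP: "adjacency_matrix G vs * P = P * adjacency_matrix G ws"
  proof (rule eq_matI)
    fix i j assume "i < dim_row (P * adjacency_matrix G ws)" "j < dim_col (P * adjacency_matrix G ws)"
    then have ij: "i < n" "j < n" by (auto simp: P_def adjacency_matrix_def n)
    have "(adjacency_matrix G vs * P) $$ (i, j) = (\<Sum>k\<in>{0..<n}.
        (if (vs ! i, vs ! k) \<in> parcs G then 1 else 0) * (if vs ! k = ws ! j then 1 else 0))"
      using ij by (simp add: P_def adjacency_matrix_def scalar_prod_def n_def)
    also have "\<dots> = (\<Sum>k\<in>{0..<n}. if k = q j then (if (vs ! i, vs ! q j) \<in> parcs G then 1 else 0) else 0)"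
      using ij pj q by (intro sum.cong) auto
    also have "\<dots> = (if (vs ! i, ws ! j) \<in> parcs G then 1 else 0)"
      using ij q by simp
    finally have 1: "(adjacency_matrix G vs * P) $$ (i, j) = \<dots>" .
    have "(P * adjacency_matrix G ws) $$ (i, j) = (\<Sum>k\<in>{0..<n}.
        (if vs ! i = ws ! k then 1 else 0) * (if (ws ! k, ws ! j) \<in> parcs G then 1 else 0))"
      using ij by (simp add: P_def adjacency_matrix_def scalar_prod_def n)
    also have "\<dots> = (\<Sum>k\<in>{0..<n}. if k = p i then (if (ws ! p i, ws ! j) \<in> parcs G then 1 else 0) else 0)"
      using ij pi p by (intro sum.cong) auto
    also have "\<dots> = (if (vs ! i, ws ! j) \<in> parcs G then 1 else 0)"
      using ij p by simp
    finally show "(adjacency_matrix G vs * P) $$ (i, j) = (P * adjacency_matrix G ws) $$ (i, j)"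
      using 1 by simp
  qed (auto simp: P_def adjacency_matrix_def n n_def)
  have c: "P \<in> carrier_mat n n" "Q \<in> carrier_mat n n"
    "adjacency_matrix G vs \<in> carrier_mat n n" "adjacency_matrix G ws \<in> carrier_mat n n"
    by (auto simp: P_def Q_def adjacency_matrix_def n n_def)
  have "P * adjacency_matrix G ws * Q = adjacency_matrix G vs * (P * Q)"
    using c by (simp add: AP[symmetric] assoc_mult_mat)
  then have "adjacency_matrix G vs = P * adjacency_matrix G ws * Q"
    using c by (simp add: PQ)
  then have "similar_mat_wit (adjacency_matrix G vs) (adjacency_matrix G ws) P Q"
    using c PQ QP by (intro similar_mat_witI) auto
  then show ?thesis
    by (intro char_poly_similar) (auto simp: similar_mat_def)
qed

text \<open>
  The roots of the characteristic polynomial with their multiplicities, in decreasing order;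
  all of them are real as the matrix is symmetric. Positions are 0-based: the list is
  \<open>[\<lambda>\<^sub>1, \<dots>, \<lambda>\<^sub>n]\<close>, hence the index shift in \<open>nth_eigenvalue\<close>.
\<close>

definition eigenvalue_list :: "'a pair_pre_digraph \<Rightarrow> real list" where
  "eigenvalue_list G =
     rev (sorted_list_of_multiset (proots (char_poly
       (adjacency_matrix G (SOME vs. distinct vs \<and> set vs = pverts G)))))"

definition nth_eigenvalue :: "'a pair_pre_digraph \<Rightarrow> nat \<Rightarrow> real" where
  "nth_eigenvalue G i = eigenvalue_list G ! (i - 1)"

text \<open>
  The constant \<open>connected\<close> of the Graph Theory library is false for the graph without vertices,
  which we do not want to count as disconnected.
\<close>

definition disconnected :: "('a, 'b) pre_digraph \<Rightarrow> bool" where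
  "disconnected G \<longleftrightarrow> verts G \<noteq> {} \<and> \<not> Digraph_Component.connected G"

definition separating_set :: "'a pair_pre_digraph \<Rightarrow> 'a set \<Rightarrow> bool" where
  "separating_set G S \<longleftrightarrow> S \<subseteq> pverts G \<and> disconnected (with_proj G \<restriction> (pverts G - S))"

text \<open>
  A complete graph has no separating set; there we use the usual convention
  \<open>\<kappa>(K\<^sub>n) = n - 1\<close>.
\<close>

definition vertex_connectivity :: "'a pair_pre_digraph \<Rightarrow> nat" where
  "vertex_connectivity G =
     (if \<exists>S. separating_set G S then LEAST m. \<exists>S. separating_set G S \<and> card S = m
      else card (pverts G) - 1)"

definition two_connected :: "'a pair_pre_digraph \<Rightarrow> bool" where
  "two_connected G \<longleftrightarrow> vertex_connectivity G \<ge> 2"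

text \<open>
  The members \<open>H i\<close> are again undirected graphs, i.e. they contain both arcs of an edge or
  neither, so disjointness of arc sets is disjointness of edge sets.
\<close>

definition edge_disjoint_spanning_two_connected ::
    "'a pair_pre_digraph \<Rightarrow> nat \<Rightarrow> (nat \<Rightarrow> 'a pair_pre_digraph) \<Rightarrow> bool" where
  "edge_disjoint_spanning_two_connected G k H \<longleftrightarrow>
     (\<forall>i<k. pair_graph (H i) \<and> spanning (with_proj (H i)) (with_proj G) \<and> two_connected (H i)) \<and>
     (\<forall>i<k. \<forall>j<k. i \<noteq> j \<longrightarrow> parcs (H i) \<inter> parcs (H j) = {})"

end

theory Submission
  imports Defs "HOL-Analysis.Function_Topology"
begin

text \<open>
  A graph on \<open>n\<close> vertices that carries a generically rigid framework in the plane has \<open>2n - 3\<close>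
  edges in independent position, and a cut vertex would leave room for at most \<open>2n - 4\<close> of them.
  So spanning subgraphs of full rank in the two-dimensional rigidity matroid are 2-connected, and
  packing them is a matroid problem: \<open>k\<close> edge-disjoint ones exist as soon as
  \<open>k (2n - 3) \<le> |E - F| + k r(F)\<close> for every set \<open>F\<close> of edges. The rank \<open>r\<close>
  is the Dilworth truncation of \<open>F \<mapsto> 2 |\<Union>F| - 3\<close>, that is, the least value of the sum of
  this bound over the parts of a partition of \<open>F\<close>; packing rests on \<open>r\<close> being monotone
  and submodular (\<open>dilworth_truncation_submodular\<close>, \<open>disjoint_full_rank_subsets\<close>), and
  2-connectedness on \<open>r\<close> being bounded by the cost of any partition
  (\<open>two_connected_of_full_rank\<close>).

  The rank condition is verified by discharging, in the manner of the Lovasz-Yemini theorem on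
  6-connected graphs (\<open>discharging\<close>). The parts of an optimal partition of \<open>F\<close> span vertex sets
  \<open>X\<close>; let \<open>A\<close> be the set of the vertices of \<open>X\<close> that lie in no other of these sets. The balance
  fails by at most \<open>3k\<close> for each \<open>X\<close> such that \<open>A\<close> is weakly attached to the rest: \<open>X - A\<close> has
  at most two vertices, and fewer than \<open>6k - 2k |X - A|\<close> edges join \<open>A\<close> to the complement of
  \<open>X\<close>. As the rank condition leaves a slack of \<open>3k\<close>, one such \<open>X\<close> is harmless, and it remains to
  exclude two.

  This is the role of the eigenvalue. Put \<open>\<gamma> = \<surd>(ab) - \<lambda>\<^sub>2\<close>. The vector \<open>\<surd>deg\<close> is an
  eigenvector for \<open>\<surd>(ab)\<close>, so \<open>\<gamma> / \<surd>(ab)\<close> bounds from below the Rayleigh quotients of the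
  normalised Laplacian on functions with weighted mean zero (\<open>spectral_gap_inequality\<close>). For
  disjoint \<open>A\<close> and \<open>B\<close> with \<open>e\<close> edges between them, the function that is \<open>1 / vol A\<close> on \<open>A\<close>, \<open>-1 / vol B\<close> on \<open>B\<close> and
  zero elsewhere shows that \<open>\<gamma> vol A \<le> \<surd>(ab) (d(A) + e)\<close>, or the same for \<open>B\<close>
  (\<open>large_boundary_of_disjoint_sets\<close>). A weakly attached \<open>A\<close> has \<open>d(A) + e < 6k + 2 max(a, b)\<close>
  if \<open>B\<close> lies outside \<open>X\<close>.
  On the other hand its vertices have so few edges leaving \<open>X\<close> that \<open>A\<close> contains at least
  \<open>\<lfloor>b/2\<rfloor>\<close> vertices of degree \<open>a\<close> and \<open>\<lfloor>a/2\<rfloor>\<close> of degree \<open>b\<close>; by the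
  inequality between the arithmetic and the geometric mean,
  \<open>vol A \<ge> 2 \<surd>(ab) \<surd>(\<lfloor>a/2\<rfloor> \<lfloor>b/2\<rfloor>)\<close>. The assumption on \<open>\<lambda>\<^sub>2\<close> makes
  \<open>\<gamma> vol A \<ge> \<surd>(ab) (6k + 2 max(a, b))\<close>, so two sets of this kind cannot coexist.
\<close>

section \<open>Dilworth truncation\<close>

definition dilworth_truncation :: "('e set \<Rightarrow> nat) \<Rightarrow> 'e set \<Rightarrow> nat" where
  "dilworth_truncation f F = (LEAST c. \<exists>P. partition_on F P \<and> c = sum f P)"

lemma dilworth_truncation_le: "partition_on F P \<Longrightarrow> dilworth_truncation f F \<le> sum f P"
  unfolding dilworth_truncation_def by (rule Least_le) blast

lemma dilworth_truncation_attained: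
  obtains P where "partition_on F P" "sum f P = dilworth_truncation f F"
proof -
  have "\<exists>c P. partition_on F P \<and> c = sum f P"
    using partition_on_singletons[of F] by blast
  then have "\<exists>P. partition_on F P \<and> dilworth_truncation f F = sum f P"
    unfolding dilworth_truncation_def by (rule LeastI_ex)
  then show thesis using that by metis
qed

lemma dilworth_truncation_empty [simp]: "dilworth_truncation f {} = 0"
  using dilworth_truncation_le[of "{}" "{}" f] by (simp add: partition_on_empty)

lemma dilworth_truncation_le_self: "dilworth_truncation f F \<le> f F"
  using dilworth_truncation_le[of F "{F}" f] by (cases "F = {}") (auto simp: partition_on_space)

lemma dilworth_truncation_Un_le:
  assumes "finite F" "finite G" "F \<inter> G = {}"
  shows "dilworth_truncation f (F \<union> G) \<le> dilworth_truncation f F + dilworth_truncation f G"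
proof -
  obtain P Q where P: "partition_on F P" "sum f P = dilworth_truncation f F"
    and Q: "partition_on G Q" "sum f Q = dilworth_truncation f G"
    by (metis dilworth_truncation_attained)
  have PQ: "C \<inter> D = {}" if "C \<in> P" "D \<in> Q" for C D
    using that partition_onD1[OF P(1)] partition_onD1[OF Q(1)] assms(3) by blast
  then have disj: "P \<inter> Q = {}" using partition_onD3[OF P(1)] by fastforce
  have "partition_on (F \<union> G) (P \<union> Q)"
  proof (rule partition_onI)
    show "\<Union>(P \<union> Q) = F \<union> G" using partition_onD1[OF P(1)] partition_onD1[OF Q(1)] by blast
    show "{} \<notin> P \<union> Q" using partition_onD3[OF P(1)] partition_onD3[OF Q(1)] by blast
    show "disjnt C D" if "C \<in> P \<union> Q" "D \<in> P \<union> Q" "C \<noteq> D" for C D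
      using that PQ partition_onD2[OF P(1)] partition_onD2[OF Q(1)]
      by (elim UnE) (auto simp: disjnt_def disjoint_def Int_commute)
  qed
  from dilworth_truncation_le[OF this, of f] show ?thesis
    using P Q disj finite_elements assms by (metis sum.union_disjoint)
qed

lemma dilworth_truncation_restrict:
  assumes "finite F" "partition_on F P"
  shows "dilworth_truncation f (B \<inter> F) \<le> (\<Sum>C\<in>{C \<in> P. B \<inter> C \<noteq> {}}. f (B \<inter> C))"
proof -
  have "(\<inter>) B ` P - {{}} = (\<inter>) B ` {C \<in> P. B \<inter> C \<noteq> {}}" by auto
  then have "dilworth_truncation f (B \<inter> F) \<le> sum f ((\<inter>) B ` {C \<in> P. B \<inter> C \<noteq> {}})"
    using dilworth_truncation_le[OF partition_on_restrict[OF assms(2)], of f B] by simp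
  also have "\<dots> \<le> sum (f \<circ> (\<inter>) B) {C \<in> P. B \<inter> C \<noteq> {}}"
    by (rule sum_image_le) (use finite_elements[OF assms] in auto)
  finally show ?thesis by simp
qed

lemma dilworth_truncation_mono:
  assumes "finite G" "F \<subseteq> G"
    and mono: "\<And>A B. A \<noteq> {} \<Longrightarrow> A \<subseteq> B \<Longrightarrow> B \<subseteq> G \<Longrightarrow> f A \<le> f B"
  shows "dilworth_truncation f F \<le> dilworth_truncation f G"
proof -
  obtain P where P: "partition_on G P" "sum f P = dilworth_truncation f G"
    by (rule dilworth_truncation_attained)
  have finP: "finite P" using finite_elements assms(1) P(1) by blast
  have "dilworth_truncation f (F \<inter> G) \<le> (\<Sum>C\<in>{C \<in> P. F \<inter> C \<noteq> {}}. f (F \<inter> C))"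
    by (rule dilworth_truncation_restrict[OF assms(1) P(1)])
  also have "\<dots> \<le> (\<Sum>C\<in>{C \<in> P. F \<inter> C \<noteq> {}}. f C)"
    using partition_onD1[OF P(1)] by (intro sum_mono mono) auto
  also have "\<dots> \<le> sum f P" using finP by (intro sum_mono2) auto
  finally show ?thesis using P(2) assms(2) by (simp add: Int_absorb2)
qed

definition intersecting_submodular :: "'e set \<Rightarrow> ('e set \<Rightarrow> nat) \<Rightarrow> bool" where
  "intersecting_submodular E f \<longleftrightarrow>
     (\<forall>A B. A \<subseteq> E \<longrightarrow> B \<subseteq> E \<longrightarrow> A \<inter> B \<noteq> {} \<longrightarrow> f (A \<union> B) + f (A \<inter> B) \<le> f A + f B)"

text \<open>
  The members of \<open>S\<close> are absorbed into \<open>B\<close> one at a time. Since they are disjoint, the union built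
  so far meets the next member \<open>C\<close> in \<open>B \<inter> C\<close> only, so each application of submodularity splits
  off exactly the term \<open>f (B \<inter> C)\<close>.
\<close>

lemma intersecting_submodular_absorb:
  assumes f: "intersecting_submodular E f" and "B \<subseteq> E"
    and "finite S" "disjoint S" "\<And>C. C \<in> S \<Longrightarrow> C \<subseteq> E" "\<And>C. C \<in> S \<Longrightarrow> B \<inter> C \<noteq> {}"
  shows "f (B \<union> \<Union>S) + (\<Sum>C\<in>S. f (B \<inter> C)) \<le> f B + sum f S"
  using assms(3-)
proof (induction S rule: finite_induct)
  case (insert C S)
  have "(B \<union> \<Union>S) \<inter> C = B \<inter> C"
    using insert.prems(1) insert.hyps(2) by (auto simp: disjoint_def)
  moreover have "f ((B \<union> \<Union>S) \<union> C) + f ((B \<union> \<Union>S) \<inter> C) \<le> f (B \<union> \<Union>S) + f C"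
  proof -
    have "B \<union> \<Union>S \<subseteq> E" "C \<subseteq> E" "(B \<union> \<Union>S) \<inter> C \<noteq> {}"
      using assms(2) insert.prems(2,3)[of C] insert.prems(2) by auto
    then show ?thesis using f unfolding intersecting_submodular_def by metis
  qed
  moreover have "f (B \<union> \<Union>S) + (\<Sum>C\<in>S. f (B \<inter> C)) \<le> f B + sum f S"
    using insert.prems by (intro insert.IH) (auto simp: disjoint_def)
  moreover have "B \<union> \<Union>(insert C S) = (B \<union> \<Union>S) \<union> C" by auto
  ultimately show ?case using insert.hyps by simp
qed simp

text \<open>
  Let \<open>S\<close> consist of the parts of an optimal partition of \<open>F\<close> that meet \<open>B\<close>. Replacing them by
  \<open>B \<union> \<Union>S\<close> gives a partition of \<open>F \<union> B\<close>, their traces on \<open>B\<close> partition \<open>F \<inter> B\<close>, and absorption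
  compares the costs.
\<close>

lemma dilworth_truncation_Un_Int_part:
  assumes f: "intersecting_submodular E f" and "finite E" "F \<subseteq> E" "B \<subseteq> E"
  shows "dilworth_truncation f (F \<union> B) + dilworth_truncation f (F \<inter> B) \<le> dilworth_truncation f F + f B"
proof (cases "B = {}")
  case False
  obtain P where P: "partition_on F P" "sum f P = dilworth_truncation f F"
    by (rule dilworth_truncation_attained)
  have finF: "finite F" using assms finite_subset by blast
  have finP: "finite P" using finite_elements[OF finF P(1)] .
  define S where "S = {C \<in> P. B \<inter> C \<noteq> {}}"
  have S: "S \<subseteq> P" by (auto simp: S_def)
  have finS: "finite S" using S finP finite_subset by blast
  have absorb: "f (B \<union> \<Union>S) + (\<Sum>C\<in>S. f (B \<inter> C)) \<le> f B + sum f S"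
    using f assms(4) finS
  proof (rule intersecting_submodular_absorb)
    show "disjoint S" using partition_onD2[OF P(1)] S by (meson pairwise_subset)
    show "C \<subseteq> E" if "C \<in> S" for C using that S partition_onD1[OF P(1)] assms(3) by blast
    show "B \<inter> C \<noteq> {}" if "C \<in> S" for C using that by (simp add: S_def)
  qed
  have part: "partition_on (F \<union> B) (insert (B \<union> \<Union>S) (P - S))"
  proof (rule partition_onI)
    show "\<Union>(insert (B \<union> \<Union>S) (P - S)) = F \<union> B" using partition_onD1[OF P(1)] S by blast
    show "{} \<notin> insert (B \<union> \<Union>S) (P - S)" using False partition_onD3[OF P(1)] by blast
    have *: "disjnt (B \<union> \<Union>S) C" if "C \<in> P - S" for C
    proof -
      have "C \<inter> D = {}" if "D \<in> S" for D
        using that \<open>C \<in> P - S\<close> disjointD[OF partition_onD2[OF P(1)], of C D] S by auto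
      then show ?thesis using that by (auto simp: disjnt_def S_def)
    qed
    show "disjnt p q" if "p \<in> insert (B \<union> \<Union>S) (P - S)" "q \<in> insert (B \<union> \<Union>S) (P - S)" "p \<noteq> q" for p q
    proof (cases "p \<in> P - S \<and> q \<in> P - S")
      case True
      then show ?thesis using disjointD[OF partition_onD2[OF P(1)], of p q] that(3) by (simp add: disjnt_def)
    next
      case False
      then show ?thesis using that * by (metis disjnt_sym insertE)
    qed
  qed
  have "dilworth_truncation f (F \<union> B) \<le> sum f (insert (B \<union> \<Union>S) (P - S))"
    by (rule dilworth_truncation_le[OF part])
  also have "\<dots> \<le> f (B \<union> \<Union>S) + sum f (P - S)"
    using finP by (simp add: sum.insert_if)
  finally have "dilworth_truncation f (F \<union> B) \<le> f (B \<union> \<Union>S) + sum f (P - S)" .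
  moreover have "dilworth_truncation f (F \<inter> B) \<le> (\<Sum>C\<in>S. f (B \<inter> C))"
    using dilworth_truncation_restrict[OF finF P(1), of f B] by (simp add: S_def Int_commute)
  moreover have "sum f P = sum f S + sum f (P - S)"
    using S finP by (metis add.commute sum.subset_diff)
  ultimately show ?thesis using absorb P(2) by linarith
qed simp

text \<open>
  An optimal partition of \<open>G\<close> is added to \<open>F\<close> part by part. Each part costs its own value of \<open>f\<close>
  and pays, by the previous lemma, for its intersection with \<open>F\<close>; subadditivity collects these
  intersections.
\<close>

lemma dilworth_truncation_submodular:
  assumes f: "intersecting_submodular E f" and "finite E" "F \<subseteq> E" "G \<subseteq> E"
  shows "dilworth_truncation f (F \<union> G) + dilworth_truncation f (F \<inter> G)
    \<le> dilworth_truncation f F + dilworth_truncation f G"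
proof -
  obtain Q where Q: "partition_on G Q" "sum f Q = dilworth_truncation f G"
    by (rule dilworth_truncation_attained)
  have "finite Q" "disjoint Q" "\<Union>Q \<subseteq> E"
    using finite_elements[OF finite_subset[OF assms(4,2)] Q(1)] partition_onD2[OF Q(1)]
      partition_onD1[OF Q(1)] assms(4) by auto
  then have "dilworth_truncation f (F \<union> \<Union>Q) + dilworth_truncation f (F \<inter> \<Union>Q)
    \<le> dilworth_truncation f F + sum f Q"
  proof (induction Q rule: finite_induct)
    case (insert C Q)
    have CQ: "C \<inter> \<Union>Q = {}" using insert.prems(1) insert.hyps(2) by (auto simp: disjoint_def)
    have fin: "finite (F \<inter> C)" "finite (F \<inter> \<Union>Q)" using assms finite_subset by (blast+)
    have "dilworth_truncation f ((F \<union> \<Union>Q) \<union> C) + dilworth_truncation f ((F \<union> \<Union>Q) \<inter> C)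
        \<le> dilworth_truncation f (F \<union> \<Union>Q) + f C"
      using f assms insert.prems by (intro dilworth_truncation_Un_Int_part) auto
    moreover have "(F \<union> \<Union>Q) \<inter> C = F \<inter> C" using CQ by blast
    moreover have "dilworth_truncation f (F \<inter> \<Union>(insert C Q))
        \<le> dilworth_truncation f (F \<inter> C) + dilworth_truncation f (F \<inter> \<Union>Q)"
    proof -
      have "F \<inter> \<Union>(insert C Q) = (F \<inter> C) \<union> (F \<inter> \<Union>Q)" by blast
      then show ?thesis using dilworth_truncation_Un_le[OF fin] CQ by (metis inf_assoc inf_bot_right inf_left_commute)
    qed
    moreover have "F \<union> \<Union>(insert C Q) = (F \<union> \<Union>Q) \<union> C" by blast
    moreover have "dilworth_truncation f (F \<union> \<Union>Q) + dilworth_truncation f (F \<inter> \<Union>Q)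
        \<le> dilworth_truncation f F + sum f Q"
      using insert.prems by (intro insert.IH) (auto simp: disjoint_def)
    ultimately show ?case using insert.hyps by simp
  qed simp
  then show ?thesis using Q partition_onD1 by metis
qed

section \<open>Packing sets of full rank\<close>

text \<open>
  The deficiency version of Rado's theorem. If some \<open>A i\<close> contains \<open>x \<noteq> y\<close>, then one of the two can
  be removed without violating the condition: violating index sets \<open>J\<close> for \<open>x\<close> and \<open>K\<close> for \<open>y\<close>
  both contain \<open>i\<close>, the two reduced unions together still contain all of \<open>A i\<close>, and submodularity
  turns the two violations into one of the condition for \<open>J \<union> K\<close> or for \<open>(J \<inter> K) - {i}\<close>. Once all
  sets have at most one element, the condition for \<open>I\<close> itself is the claim.
\<close>

lemma rado_partial_transversal:
  fixes \<rho> :: "'b set \<Rightarrow> nat" and A :: "'i \<Rightarrow> 'b set"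
  assumes "finite I" and "\<And>i. i \<in> I \<Longrightarrow> finite (A i)" and "\<And>i. i \<in> I \<Longrightarrow> A i \<subseteq> U"
    and mono: "\<And>S T. S \<subseteq> T \<Longrightarrow> T \<subseteq> U \<Longrightarrow> \<rho> S \<le> \<rho> T"
    and submod: "\<And>S T. S \<subseteq> U \<Longrightarrow> T \<subseteq> U \<Longrightarrow> \<rho> (S \<union> T) + \<rho> (S \<inter> T) \<le> \<rho> S + \<rho> T"
    and cond: "\<And>J. J \<subseteq> I \<Longrightarrow> card J + r \<le> \<rho> (\<Union>i\<in>J. A i) + card I"
  shows "\<exists>A'. (\<forall>i\<in>I. A' i \<subseteq> A i \<and> card (A' i) \<le> 1) \<and> r \<le> \<rho> (\<Union>i\<in>I. A' i)"
  using assms(2,3) cond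
proof (induction "\<Sum>i\<in>I. card (A i)" arbitrary: A rule: less_induct)
  case less
  show ?case
  proof (cases "\<forall>i\<in>I. card (A i) \<le> 1")
    case True
    then show ?thesis using less.prems(3)[of I] by (intro exI[of _ A]) auto
  next
    case False
    then obtain i where i: "i \<in> I" "\<not> card (A i) \<le> 1" by blast
    then obtain x y where xy: "x \<in> A i" "y \<in> A i" "x \<noteq> y"
      using less.prems(1) by (metis card_le_Suc0_iff_eq One_nat_def)
    have step: "\<exists>A'. (\<forall>j\<in>I. A' j \<subseteq> A j \<and> card (A' j) \<le> 1) \<and> r \<le> \<rho> (\<Union>j\<in>I. A' j)"
      if z: "z \<in> A i" and cond': "\<And>J. J \<subseteq> I \<Longrightarrow> card J + r \<le> \<rho> (\<Union>j\<in>J. (A(i := A i - {z})) j) + card I" for z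
    proof -
      have "card (A i - {z}) < card (A i)" using z i less.prems(1) by (simp add: card_gt_0_iff card_Diff_singleton)
      then have "(\<Sum>j\<in>I. card ((A(i := A i - {z})) j)) < (\<Sum>j\<in>I. card (A j))"
        using i assms(1) by (intro sum_strict_mono_ex1) auto
      then have "\<exists>A'. (\<forall>j\<in>I. A' j \<subseteq> (A(i := A i - {z})) j \<and> card (A' j) \<le> 1) \<and> r \<le> \<rho> (\<Union>j\<in>I. A' j)"
        using less.prems(1,2) cond' by (intro less.hyps) (auto split: if_splits)
      then show ?thesis by (metis Diff_subset fun_upd_apply subset_trans)
    qed
    have bad: "\<exists>J\<subseteq>I. i \<in> J \<and> \<rho> ((A i - {z}) \<union> (\<Union>j\<in>J - {i}. A j)) + card I < card J + r"
      if "J \<subseteq> I" "\<not> card J + r \<le> \<rho> (\<Union>j\<in>J. (A(i := A i - {z})) j) + card I" for z J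
    proof -
      have "i \<in> J"
      proof (rule ccontr)
        assume "i \<notin> J"
        then have "(\<Union>j\<in>J. (A(i := A i - {z})) j) = (\<Union>j\<in>J. A j)" by auto
        then show False using that less.prems(3)[of J] by simp
      qed
      moreover from this have "(\<Union>j\<in>J. (A(i := A i - {z})) j) = (A i - {z}) \<union> (\<Union>j\<in>J - {i}. A j)"
        by (auto split: if_splits)
      ultimately show ?thesis using that by (metis not_le)
    qed
    show ?thesis
    proof (rule ccontr)
      assume contra: "\<not> ?thesis"
      obtain J where J: "J \<subseteq> I" "i \<in> J" "\<rho> ((A i - {x}) \<union> (\<Union>j\<in>J - {i}. A j)) + card I < card J + r"
        using step[OF xy(1)] contra bad[of _ x] by metis
      obtain K where K: "K \<subseteq> I" "i \<in> K" "\<rho> ((A i - {y}) \<union> (\<Union>j\<in>K - {i}. A j)) + card I < card K + r"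
        using step[OF xy(2)] contra bad[of _ y] by metis
      define S where "S = (A i - {x}) \<union> (\<Union>j\<in>J - {i}. A j)"
      define T where "T = (A i - {y}) \<union> (\<Union>j\<in>K - {i}. A j)"
      have ST: "S \<subseteq> U" "T \<subseteq> U" using J K i less.prems(2) unfolding S_def T_def by (blast+)
      have un: "S \<union> T = (\<Union>j\<in>J \<union> K. A j)" using xy J K unfolding S_def T_def by blast
      have "(\<Union>j\<in>J \<inter> K - {i}. A j) \<subseteq> S \<inter> T" unfolding S_def T_def by blast
      then have int: "\<rho> (\<Union>j\<in>J \<inter> K - {i}. A j) \<le> \<rho> (S \<inter> T)" using ST by (intro mono) auto
      have fin: "finite J" "finite K" using J K assms(1) finite_subset by (blast+)
      have "card (J \<union> K) + r \<le> \<rho> (S \<union> T) + card I"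
        using less.prems(3)[of "J \<union> K"] J K un by simp
      moreover have "card (J \<inter> K - {i}) + r \<le> \<rho> (S \<inter> T) + card I"
        using less.prems(3)[of "J \<inter> K - {i}"] J int by (meson Diff_subset add_le_mono1 inf.coboundedI1 order_trans)
      moreover have "card (J \<union> K) + card (J \<inter> K) = card J + card K"
        using card_Un_Int[OF fin] by simp
      moreover have "card (J \<inter> K) = Suc (card (J \<inter> K - {i}))"
        using J K fin by (metis IntI card.remove finite_Int)
      ultimately show False
        using submod[OF ST] J(3) K(3) unfolding S_def[symmetric] T_def[symmetric] by linarith
    qed
  qed
qed

text \<open>
  The existence part of the matroid base packing theorem, for a monotone submodular function in place
  of a rank function. Each element \<open>e\<close> may be put into one of \<open>k\<close> copies of the ground set, so Rado's
  theorem is applied to the sets \<open>{e} \<times> {..<k}\<close> and the sum of \<open>g\<close> over the \<open>k\<close> layers. A partial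
  transversal chooses at most one layer for each element, and a total rank of \<open>k * g E\<close> forces each
  layer to have rank \<open>g E\<close>.
\<close>

lemma disjoint_full_rank_subsets:
  fixes g :: "'e set \<Rightarrow> nat"
  assumes "finite E"
    and mono: "\<And>F G. F \<subseteq> G \<Longrightarrow> G \<subseteq> E \<Longrightarrow> g F \<le> g G"
    and submod: "\<And>F G. F \<subseteq> E \<Longrightarrow> G \<subseteq> E \<Longrightarrow> g (F \<union> G) + g (F \<inter> G) \<le> g F + g G"
    and cond: "\<And>F. F \<subseteq> E \<Longrightarrow> k * g E \<le> card (E - F) + k * g F"
  shows "\<exists>S. (\<forall>i<k. S i \<subseteq> E \<and> g (S i) = g E) \<and> (\<forall>i j. i \<noteq> j \<longrightarrow> S i \<inter> S j = {})"
proof -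
  define layer where "layer T i = {e. (e, i) \<in> T}" for T :: "('e \<times> nat) set" and i
  define \<rho> where "\<rho> T = (\<Sum>i<k. g (layer T i))" for T
  define A where "A e = {e} \<times> {..<k}" for e :: 'e
  have "\<exists>A'. (\<forall>e\<in>E. A' e \<subseteq> A e \<and> card (A' e) \<le> 1) \<and> k * g E \<le> \<rho> (\<Union>e\<in>E. A' e)"
  proof (rule rado_partial_transversal[where U = "E \<times> {..<k}"])
    fix S T :: "('e \<times> nat) set"
    show "\<rho> S \<le> \<rho> T" if "S \<subseteq> T" "T \<subseteq> E \<times> {..<k}"
      unfolding \<rho>_def using that by (intro sum_mono mono) (auto simp: layer_def)
    show "\<rho> (S \<union> T) + \<rho> (S \<inter> T) \<le> \<rho> S + \<rho> T" if "S \<subseteq> E \<times> {..<k}" "T \<subseteq> E \<times> {..<k}"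
    proof -
      have "layer (S \<union> T) i = layer S i \<union> layer T i" "layer (S \<inter> T) i = layer S i \<inter> layer T i" for i
        by (auto simp: layer_def)
      moreover have "layer S i \<subseteq> E" "layer T i \<subseteq> E" for i using that by (auto simp: layer_def)
      ultimately show ?thesis
        unfolding \<rho>_def sum.distrib[symmetric] by (intro sum_mono) (simp add: submod)
    qed
  next
    fix J assume J: "J \<subseteq> E"
    have "layer (\<Union>e\<in>J. A e) i = J" if "i < k" for i using that by (auto simp: layer_def A_def)
    then have "\<rho> (\<Union>e\<in>J. A e) = k * g J" by (simp add: \<rho>_def)
    moreover have "card E = card (E - J) + card J"
      using J assms(1) by (metis add.commute card_Diff_subset card_mono finite_subset le_add_diff_inverse)
    ultimately show "card J + k * g E \<le> \<rho> (\<Union>e\<in>J. A e) + card E" using cond[OF J] by linarith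
  qed (auto simp: A_def assms(1))
  then obtain A' where A': "\<And>e. e \<in> E \<Longrightarrow> A' e \<subseteq> A e" "\<And>e. e \<in> E \<Longrightarrow> card (A' e) \<le> 1"
    and rank: "k * g E \<le> \<rho> (\<Union>e\<in>E. A' e)" by blast
  define S where "S i = layer (\<Union>e\<in>E. A' e) i" for i
  have SE: "S i \<subseteq> E" for i using A'(1) by (fastforce simp: S_def layer_def A_def)
  have le: "g (S i) \<le> g E" for i using SE by (intro mono) auto
  have "g (S i) = g E" if i: "i < k" for i
  proof (rule ccontr)
    assume "g (S i) \<noteq> g E"
    then have "g (S i) < g E" using le[of i] by simp
    then have "(\<Sum>i<k. g (S i)) < (\<Sum>i<k. g E)"
      using i le by (intro sum_strict_mono_ex1) auto
    then show False using rank by (simp add: \<rho>_def S_def)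
  qed
  moreover have "S i \<inter> S j = {}" if "i \<noteq> j" for i j
  proof -
    have False if "e \<in> S i" "e \<in> S j" for e
    proof -
      have "e \<in> E" using that SE by blast
      have "(e, i) \<in> A' e" "(e, j) \<in> A' e" using that A'(1) by (fastforce simp: S_def layer_def A_def)+
      moreover have "finite (A' e)" using A'(1)[OF \<open>e \<in> E\<close>] by (rule finite_subset) (simp add: A_def)
      ultimately show False using A'(2)[OF \<open>e \<in> E\<close>] \<open>i \<noteq> j\<close> by (metis One_nat_def card_le_Suc0_iff_eq prod.inject)
    qed
    then show ?thesis by blast
  qed
  ultimately show ?thesis using SE by (intro exI[of _ S]) blast
qed

section \<open>The second largest eigenvalue of a symmetric matrix\<close>

lemma linear_coefficient_zero:
  fixes \<beta> \<gamma> :: real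
  assumes "\<And>t. 2 * t * \<beta> + t\<^sup>2 * \<gamma> \<le> 0"
  shows "\<beta> = 0"
proof (rule ccontr)
  assume b: "\<beta> \<noteq> 0"
  define t where "t = \<beta> / (\<bar>\<gamma>\<bar> + 1)"
  have "2 * t * \<beta> = 2 * \<beta>\<^sup>2 / (\<bar>\<gamma>\<bar> + 1)" by (simp add: t_def power2_eq_square)
  moreover have "0 \<le> t\<^sup>2 * (\<gamma> + \<bar>\<gamma>\<bar> + 1)" by (intro mult_nonneg_nonneg) auto
  then have "t\<^sup>2 * \<gamma> \<ge> - (t\<^sup>2 * (\<bar>\<gamma>\<bar> + 1))" by (simp add: algebra_simps)
  moreover have "t\<^sup>2 * (\<bar>\<gamma>\<bar> + 1) = \<beta>\<^sup>2 / (\<bar>\<gamma>\<bar> + 1)"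
    by (simp add: t_def power2_eq_square)
  moreover have "\<beta>\<^sup>2 / (\<bar>\<gamma>\<bar> + 1) > 0" using b by (simp add: add_nonneg_pos)
  ultimately show False using assms[of t] by simp
qed

lemma compact_unit_sphere_orthogonal:
  fixes w :: "'i \<Rightarrow> real"
  assumes "finite V"
  shows "compact {f. (\<forall>v. v \<notin> V \<longrightarrow> f v = 0) \<and> (\<Sum>v\<in>V. (f v)\<^sup>2) = 1 \<and> (\<Sum>v\<in>V. f v * w v) = 0}"
    (is "compact ?K")
proof -
  \<comment> \<open>Inside a product of intervals the sphere is cut out by two closed conditions. Setting the
    coordinates outside V to zero keeps the product compact.\<close>
  define B where "B = (\<Pi>\<^sub>E v\<in>UNIV. if v \<in> V then {-1..1} else {0::real})"
  have "compactin (product_topology (\<lambda>_. euclidean) UNIV) B"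
    unfolding B_def compactin_PiE by auto
  then have B: "compact B" by (simp add: euclidean_product_topology)
  have "?K = B \<inter> {f. (\<Sum>v\<in>V. (f v)\<^sup>2) = 1} \<inter> {f. (\<Sum>v\<in>V. f v * w v) = 0}"
  proof -
    have "f v \<in> {-1..1}" if "(\<Sum>v\<in>V. (f v)\<^sup>2) = 1" "v \<in> V" for f :: "'i \<Rightarrow> real" and v
    proof -
      have "(f v)\<^sup>2 \<le> 1" using member_le_sum[of v V "\<lambda>v. (f v)\<^sup>2"] that assms by simp
      then show ?thesis by (simp add: abs_square_le_1 abs_le_iff minus_le_iff)
    qed
    then show ?thesis by (fastforce simp: B_def PiE_iff split: if_splits)
  qed
  moreover have "closed {f :: 'i \<Rightarrow> real. (\<Sum>v\<in>V. (f v)\<^sup>2) = 1}"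
    by (intro closed_Collect_eq continuous_intros) auto
  moreover have "closed {f :: 'i \<Rightarrow> real. (\<Sum>v\<in>V. f v * w v) = 0}"
    by (intro closed_Collect_eq continuous_intros) auto
  ultimately show ?thesis using B by (simp add: compact_Int_closed)
qed

text \<open>
  The quadratic form attains its maximum \<open>\<mu>\<close> on the compact set of unit vectors orthogonal to \<open>w\<close>,
  say at \<open>f\<close>. The residual \<open>r = M f - \<mu> f\<close> is orthogonal to \<open>w\<close> because \<open>w\<close> is an eigenvector of a
  symmetric matrix. So \<open>f\<close> may be varied in the direction \<open>r\<close>, and the first-order condition says
  \<open>\<langle>r, r\<rangle> = 0\<close>.
\<close>

lemma rayleigh_maximum_orthogonal:
  fixes M :: "'i \<Rightarrow> 'i \<Rightarrow> real" and w :: "'i \<Rightarrow> real"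
  assumes fin: "finite V" and sym: "\<And>u v. u \<in> V \<Longrightarrow> v \<in> V \<Longrightarrow> M u v = M v u"
    and w: "\<And>u. u \<in> V \<Longrightarrow> (\<Sum>v\<in>V. M u v * w v) = \<rho> * w u"
    and ex: "\<exists>h. (\<Sum>v\<in>V. h v * w v) = 0 \<and> (\<exists>v\<in>V. h v \<noteq> 0)"
  obtains \<mu> f where "(\<Sum>v\<in>V. f v * w v) = 0" "(\<Sum>v\<in>V. (f v)\<^sup>2) = 1"
    "\<And>u. u \<in> V \<Longrightarrow> (\<Sum>v\<in>V. M u v * f v) = \<mu> * f u"
    "\<And>h. (\<Sum>v\<in>V. h v * w v) = 0 \<Longrightarrow> (\<Sum>u\<in>V. \<Sum>v\<in>V. M u v * h u * h v) \<le> \<mu> * (\<Sum>v\<in>V. (h v)\<^sup>2)"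
proof -
  define ip where "ip f g = (\<Sum>v\<in>V. f v * g v)" for f g :: "'i \<Rightarrow> real"
  define T where "T f u = (\<Sum>v\<in>V. M u v * f v)" for f u
  define K where "K = {f. (\<forall>v. v \<notin> V \<longrightarrow> f v = 0) \<and> ip f f = 1 \<and> ip f w = 0}"
  have K: "compact K"
    using compact_unit_sphere_orthogonal[OF fin, of w] by (simp add: K_def ip_def power2_eq_square)
  have ipcom: "ip f g = ip g f" for f g by (simp add: ip_def mult.commute)
  have ipadd: "ip f (\<lambda>v. g v + t * h v) = ip f g + t * ip f h" for f g h t
    by (simp add: ip_def algebra_simps sum.distrib sum_distrib_left)
  have ipadd': "ip (\<lambda>v. g v + t * h v) f = ip g f + t * ip h f" for f g h t
    using ipadd ipcom by metis
  have Tadd: "T (\<lambda>v. g v + t * h v) = (\<lambda>v. T g v + t * T h v)" for g h t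
    by (simp add: T_def algebra_simps sum.distrib sum_distrib_left fun_eq_iff)
  have sa: "ip f (T g) = ip (T f) g" for f g
  proof -
    have "ip f (T g) = (\<Sum>u\<in>V. \<Sum>v\<in>V. M u v * f u * g v)"
      by (simp add: ip_def T_def sum_distrib_left mult_ac)
    also have "\<dots> = (\<Sum>v\<in>V. \<Sum>u\<in>V. M u v * f u * g v)" by (rule sum.swap)
    also have "\<dots> = (\<Sum>v\<in>V. \<Sum>u\<in>V. M v u * f u * g v)" using sym by (intro sum.cong) auto
    also have "\<dots> = ip (T f) g"
      by (simp add: ip_def T_def sum_distrib_left sum_distrib_right mult_ac)
    finally show ?thesis .
  qed
  have Q: "(\<Sum>u\<in>V. \<Sum>v\<in>V. M u v * h u * h v) = ip h (T h)" for h
    by (simp add: ip_def T_def sum_distrib_left mult_ac)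
  have ippos: "ip h h > 0" if "v \<in> V" "h v \<noteq> 0" for h v
    unfolding ip_def by (rule sum_pos2[OF fin that(1)]) (use that in \<open>auto simp: zero_less_mult_iff\<close>)
  have normalise: "\<exists>h'\<in>K. ip h' (T h') = ip h (T h) / ip h h"
    if "ip h w = 0" "ip h h > 0" for h
  proof
    let ?h = "\<lambda>v. if v \<in> V then h v / sqrt (ip h h) else 0"
    have "ip ?h ?h = (\<Sum>v\<in>V. h v * h v / ip h h)"
      unfolding ip_def[of ?h ?h] using that(2) by (intro sum.cong) auto
    also have "\<dots> = 1" using that(2) by (simp flip: sum_divide_distrib ip_def)
    finally have 1: "ip ?h ?h = 1" .
    have "ip ?h w = (\<Sum>v\<in>V. h v * w v / sqrt (ip h h))"
      unfolding ip_def[of ?h w] by (intro sum.cong) auto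
    also have "\<dots> = 0" using that(1) by (simp flip: sum_divide_distrib ip_def)
    finally show "?h \<in> K" using 1 by (simp add: K_def)
    have T: "T ?h u = T h u / sqrt (ip h h)" for u
      unfolding T_def by (auto simp: sum_divide_distrib intro!: sum.cong)
    have "ip ?h (T ?h) = (\<Sum>v\<in>V. h v * T h v / ip h h)"
      unfolding ip_def[of ?h "T ?h"] T using that(2) by (intro sum.cong) auto
    then show "ip ?h (T ?h) = ip h (T h) / ip h h"
      by (simp flip: sum_divide_distrib ip_def)
  qed
  have "K \<noteq> {}"
  proof -
    obtain h v where "ip h w = 0" "v \<in> V" "h v \<noteq> 0" using ex by (auto simp: ip_def)
    then show ?thesis using normalise[of h] ippos by blast
  qed
  moreover have "continuous_on K (\<lambda>f. ip f (T f))"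
    unfolding ip_def T_def by (intro continuous_intros continuous_on_product_coordinates[THEN continuous_on_subset]) auto
  ultimately obtain f where f: "f \<in> K" and fmax: "\<And>h. h \<in> K \<Longrightarrow> ip h (T h) \<le> ip f (T f)"
    using continuous_attains_sup[OF K] by metis
  define \<mu> where "\<mu> = ip f (T f)"
  have max: "ip h (T h) \<le> \<mu> * ip h h" if hw: "ip h w = 0" for h
  proof (cases "\<exists>v\<in>V. h v \<noteq> 0")
    case True
    then have p: "ip h h > 0" using ippos by blast
    obtain h' where "h' \<in> K" "ip h' (T h') = ip h (T h) / ip h h"
      using normalise[OF hw p] by blast
    then have "ip h (T h) / ip h h \<le> \<mu>" using fmax[of h'] by (simp add: \<mu>_def)
    then show ?thesis using p by (simp add: pos_divide_le_eq)
  next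
    case False
    then show ?thesis by (simp add: ip_def)
  qed
  define r where "r u = T f u + (-\<mu>) * f u" for u
  have fK: "ip f f = 1" "ip f w = 0" using f by (auto simp: K_def)
  have rw: "ip r w = 0"
  proof -
    have "ip r w = ip f (T w)" unfolding r_def ipadd' using fK sa by simp
    also have "\<dots> = \<rho> * ip f w"
      using w by (simp add: ip_def T_def sum_distrib_left mult_ac)
    finally show ?thesis using fK by simp
  qed
  have "ip r r = 0"
  proof (rule linear_coefficient_zero)
    fix t
    have "ip (\<lambda>v. f v + t * r v) w = 0" using rw fK by (simp add: ipadd')
    from max[OF this]
    have "ip f (T f) + t * ip r (T f) + t * (ip f (T r) + t * ip r (T r))
        \<le> \<mu> * (ip f f + t * ip r f + t * (ip f r + t * ip r r))"
      by (simp add: Tadd ipadd ipadd')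
    moreover have "ip f (T r) = ip r (T f)" using sa ipcom by metis
    moreover have "ip r r = ip r (T f) - \<mu> * ip f r"
    proof -
      have "ip r r = ip r (\<lambda>u. T f u + (-\<mu>) * f u)" by (simp only: r_def[abs_def])
      then show ?thesis by (simp only: ipadd ipcom[of r f])
    qed
    moreover have "ip f (T f) = \<mu>" "ip f f = 1" "ip r f = ip f r"
      using fK ipcom by (auto simp: \<mu>_def)
    ultimately have "\<mu> + t * (ip r r + \<mu> * ip f r) + t * (ip r r + \<mu> * ip f r + t * ip r (T r))
        \<le> \<mu> * (1 + t * ip f r + t * (ip f r + t * ip r r))"
      by simp
    then show "2 * t * ip r r + t\<^sup>2 * (ip r (T r) - \<mu> * ip r r) \<le> 0"
      by (simp add: algebra_simps power2_eq_square)
  qed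
  then have "r v = 0" if "v \<in> V" for v
    using ippos[OF that, of r] by (cases "r v = 0") auto
  then have ev: "T f u = \<mu> * f u" if "u \<in> V" for u using that by (simp add: r_def)
  show thesis
    by (rule that[of f \<mu>]) (use fK ev max in \<open>auto simp: Q, auto simp: ip_def T_def power2_eq_square\<close>)
qed

lemma eigenvalue_of_function:
  fixes A :: "real mat"
  assumes A: "A \<in> carrier_mat n n" and nz: "\<exists>i<n. f i \<noteq> 0"
    and ev: "\<And>i. i < n \<Longrightarrow> (\<Sum>j<n. A $$ (i, j) * f j) = e * f i"
  shows "poly (char_poly A) e = 0"
proof -
  have "eigenvector A (vec n f) e"
    unfolding eigenvector_def using A nz ev
    by (auto simp: vec_eq_iff scalar_prod_def lessThan_atLeast0)
  then show ?thesis using eigenvalue_root_char_poly[OF A] by (auto simp: eigenvalue_def)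
qed

text \<open>
  Two independent eigenvectors have a combination that vanishes at a prescribed index \<open>i\<close>. Hence \<open>e\<close>
  remains an eigenvalue after deletion of the \<open>i\<close>-th row and column, for every \<open>i\<close>, and the
  derivative of the characteristic polynomial is the sum of the characteristic polynomials of these
  minors. That \<open>g\<close> has no zero entry makes the combination explicit.
\<close>

lemma double_root_char_poly:
  fixes A :: "real mat"
  assumes A: "A \<in> carrier_mat n n"
    and f: "\<exists>i<n. f i \<noteq> 0" and g: "\<And>i. i < n \<Longrightarrow> g i \<noteq> 0"
    and ind: "\<And>c. \<exists>i<n. f i \<noteq> c * g i"
    and evf: "\<And>i. i < n \<Longrightarrow> (\<Sum>j<n. A $$ (i, j) * f j) = e * f i"
    and evg: "\<And>i. i < n \<Longrightarrow> (\<Sum>j<n. A $$ (i, j) * g j) = e * g i"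
  shows "poly (pderiv (char_poly A)) e = 0"
proof -
  have "poly (char_poly (mat_delete A i i)) e = 0" if i: "i < n" for i
  proof -
    define h where "h j = f j - f i / g i * g j" for j
    have hi: "h i = 0" using g[OF i] by (simp add: h_def)
    have evh: "(\<Sum>j<n. A $$ (k, j) * h j) = e * h k" if "k < n" for k
    proof -
      have "(\<Sum>j<n. A $$ (k, j) * h j) = (\<Sum>j<n. A $$ (k, j) * f j) - f i / g i * (\<Sum>j<n. A $$ (k, j) * g j)"
        by (simp add: h_def algebra_simps sum_subtractf sum_distrib_left)
      then show ?thesis using evf evg that by (simp add: h_def algebra_simps)
    qed
    obtain k where k: "k < n" "h k \<noteq> 0" using ind[of "f i / g i"] by (auto simp: h_def)
    obtain m where n: "n = Suc m" using i by (cases n) auto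
    define s where "s j = insert_index i j" for j
    have bij: "bij_betw s {..<m} ({..<n} - {i})"
    proof -
      have "inj s" by (rule injI) (auto simp: s_def insert_index_def split: if_splits)
      moreover have "s j \<in> {..<n} - {i}" if "j < m" for j
        using that n by (simp add: s_def insert_index_def)
      moreover have "x \<in> s ` {..<m}" if "x < n" "x \<noteq> i" for x
      proof (rule image_eqI)
        show "x = s (delete_index i x)" using that by (simp add: s_def insert_delete_index)
        show "delete_index i x \<in> {..<m}" using that i n by (auto simp: delete_index_def)
      qed
      ultimately show ?thesis by (auto simp: bij_betw_def intro: inj_on_subset)
    qed
    show ?thesis
    proof (rule eigenvalue_of_function)
      show "mat_delete A i i \<in> carrier_mat m m" using A n by (auto simp: mat_delete_def)
      have "k \<in> s ` {..<m}" using bij k hi by (auto simp: bij_betw_def)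
      then show "\<exists>j<m. (h \<circ> s) j \<noteq> 0" using k by auto
      fix j assume j: "j < m"
      have sj: "s j < n" "s j \<noteq> i" using bij j by (auto simp: bij_betw_def)
      have "(\<Sum>l<m. mat_delete A i i $$ (j, l) * (h \<circ> s) l) = (\<Sum>l<m. A $$ (s j, s l) * h (s l))"
        using A n i j by (intro sum.cong) (auto simp: mat_delete_def s_def insert_index_def)
      also have "\<dots> = (\<Sum>l\<in>{..<n} - {i}. A $$ (s j, l) * h l)"
        by (rule sum.reindex_bij_betw[OF bij])
      also have "\<dots> = (\<Sum>l<n. A $$ (s j, l) * h l)"
        using hi by (intro sum.mono_neutral_left) auto
      finally show "(\<Sum>l<m. mat_delete A i i $$ (j, l) * (h \<circ> s) l) = e * (h \<circ> s) j"
        using evh[OF sj(1)] by simp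
    qed
  qed
  then show ?thesis unfolding pderiv_char_poly[OF A] poly_sum by simp
qed

lemma two_roots_in_proots:
  fixes p :: "real poly"
  assumes "p \<noteq> 0" "poly p x = 0" "poly p y = 0" "x = y \<Longrightarrow> poly (pderiv p) x = 0"
  shows "{#x, y#} \<subseteq># proots p"
proof -
  obtain q where q: "p = [:-x, 1:] * q" using assms(2) by (auto simp: poly_eq_0_iff_dvd)
  have "poly q y = 0"
  proof (cases "x = y")
    case True
    have "pderiv p = [:-x, 1:] * pderiv q + q * pderiv [:-x, 1:]"
      unfolding q by (rule pderiv_mult)
    then have "poly (pderiv p) x = poly q x" by (simp add: pderiv_pCons)
    then show ?thesis using assms True by simp
  next
    case False
    have "poly p y = (y - x) * poly q y" unfolding q by (simp add: algebra_simps)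
    then show ?thesis using assms(3) False by simp
  qed
  moreover have "q \<noteq> 0" using assms(1) q by auto
  ultimately have "y \<in># proots q" by simp
  moreover have "proots p = {#x#} + proots q" 
    using \<open>q \<noteq> 0\<close> proots_linear_factor[of "- x"] unfolding q by (subst proots_mult) auto
  ultimately show ?thesis by simp
qed

lemma second_largest_ge:
  fixes M :: "real multiset"
  assumes sub: "{#x, y#} \<subseteq># M" and "y \<le> x"
  shows "y \<le> rev (sorted_list_of_multiset M) ! 1"
proof (rule ccontr)
  define xs where "xs = rev (sorted_list_of_multiset M)"
  assume "\<not> y \<le> rev (sorted_list_of_multiset M) ! 1"
  then have less: "xs ! 1 < y" by (simp add: xs_def)
  have m: "mset xs = M" by (simp add: xs_def)
  have sor: "sorted (rev xs)" by (simp add: xs_def)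
  have "size {#x, y#} \<le> size M" using sub by (rule size_mset_mono)
  then have len: "length xs \<ge> 2" using m by (metis size_mset size_add_mset size_empty numeral_2_eq_2)
  then obtain a b zs where xs: "xs = a # b # zs"
    by (metis One_nat_def Suc_1 Suc_le_length_iff)
  have b: "b < y" using less xs by simp
  have zs: "\<forall>z\<in>set zs. z \<le> b" using sor xs by (auto simp: sorted_append)
  have "filter_mset (\<lambda>z. y \<le> z) {#x, y#} \<subseteq># filter_mset (\<lambda>z. y \<le> z) M"
    using sub by (rule multiset_filter_mono)
  then have "size {#x, y#} \<le> size (filter_mset (\<lambda>z. y \<le> z) M)"
    using \<open>y \<le> x\<close> by (intro size_mset_mono) simp
  also have "filter_mset (\<lambda>z. y \<le> z) M = mset (filter (\<lambda>z. y \<le> z) xs)" using m by (simp add: mset_filter)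
  also have "filter (\<lambda>z. y \<le> z) zs = []" using zs b by (auto simp: filter_empty_conv)
  then have "size (mset (filter (\<lambda>z. y \<le> z) xs)) \<le> 1" using xs b by simp
  finally show False by simp
qed

text \<open>
  The constrained maximum \<open>\<mu>\<close> is an eigenvalue with an eigenvector orthogonal to \<open>w\<close>, and it is at
  most \<open>\<rho>\<close>. So \<open>\<rho>\<close> and \<open>\<mu>\<close> occur together among the roots of the characteristic polynomial, with
  multiplicity two if they coincide, and the second entry of the decreasing list of roots is at
  least \<open>\<mu>\<close>.
\<close>

lemma rayleigh_le_second_eigenvalue:
  fixes A :: "real mat" and w h :: "nat \<Rightarrow> real"
  assumes A: "A \<in> carrier_mat n n" and n: "n \<ge> 2"
    and sym: "\<And>i j. i < n \<Longrightarrow> j < n \<Longrightarrow> A $$ (i, j) = A $$ (j, i)"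
    and w0: "\<And>i. i < n \<Longrightarrow> w i \<noteq> 0"
    and w: "\<And>i. i < n \<Longrightarrow> (\<Sum>j<n. A $$ (i, j) * w j) = \<rho> * w i"
    and top: "\<And>h. (\<Sum>i<n. \<Sum>j<n. A $$ (i, j) * h i * h j) \<le> \<rho> * (\<Sum>i<n. (h i)\<^sup>2)"
    and h: "(\<Sum>i<n. h i * w i) = 0"
  shows "(\<Sum>i<n. \<Sum>j<n. A $$ (i, j) * h i * h j)
    \<le> rev (sorted_list_of_multiset (proots (char_poly A))) ! 1 * (\<Sum>i<n. (h i)\<^sup>2)"
proof -
  have "\<exists>h. (\<Sum>i<n. h i * w i) = 0 \<and> (\<exists>i<n. h i \<noteq> 0)"
  proof (intro exI conjI)
    \<comment> \<open>A nonzero vector orthogonal to w that lives on the first two coordinates.\<close>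
    let ?h = "\<lambda>i. if i = 0 then w 1 else if i = 1 then - w 0 else (0::real)"
    have "(\<Sum>i<n. ?h i * w i) = (\<Sum>i\<in>{0, 1}. ?h i * w i)"
      using n by (intro sum.mono_neutral_right) auto
    then show "(\<Sum>i<n. ?h i * w i) = 0" by simp
    show "0 < n" "?h 0 \<noteq> 0" using n w0[of 1] by auto
  qed
  then have ex: "\<exists>h. (\<Sum>i\<in>{..<n}. h i * w i) = 0 \<and> (\<exists>i\<in>{..<n}. h i \<noteq> 0)" by auto
  obtain \<mu> f where f: "(\<Sum>i<n. f i * w i) = 0" "(\<Sum>i<n. (f i)\<^sup>2) = 1"
    "\<And>i. i < n \<Longrightarrow> (\<Sum>j<n. A $$ (i, j) * f j) = \<mu> * f i"
    and max: "\<And>h. (\<Sum>i<n. h i * w i) = 0 \<Longrightarrow>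
      (\<Sum>i<n. \<Sum>j<n. A $$ (i, j) * h i * h j) \<le> \<mu> * (\<Sum>i<n. (h i)\<^sup>2)"
    by (rule rayleigh_maximum_orthogonal[of "{..<n}" "\<lambda>i j. A $$ (i, j)" w \<rho>])
      (use sym w ex in auto)
  have "(\<Sum>i<n. \<Sum>j<n. A $$ (i, j) * f i * f j) = (\<Sum>i<n. f i * (\<mu> * f i))"
    using f(3) by (simp add: mult_ac flip: sum_distrib_left)
  also have "\<dots> = \<mu> * (\<Sum>i<n. (f i)\<^sup>2)" by (simp add: sum_distrib_left power2_eq_square mult_ac)
  finally have "\<mu> \<le> \<rho>" using top[of f] f(2) by simp
  have fnz: "\<exists>i<n. f i \<noteq> 0"
  proof (rule ccontr)
    assume "\<not> ?thesis"
    then show False using f(2) by simp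
  qed
  have ind: "\<exists>i<n. f i \<noteq> t * w i" for t
  proof (rule ccontr)
    assume "\<not> ?thesis"
    then have eq: "f i = t * w i" if "i < n" for i using that by blast
    have "(\<Sum>i<n. f i * w i) = t * (\<Sum>i<n. (w i)\<^sup>2)"
      using eq by (simp add: sum_distrib_left power2_eq_square mult_ac)
    moreover have "(\<Sum>i<n. (w i)\<^sup>2) > 0"
      using n w0 by (intro sum_pos) (auto simp: lessThan_empty_iff)
    ultimately have "t = 0" using f(1) by simp
    then show False using fnz eq by auto
  qed
  have "{#\<rho>, \<mu>#} \<subseteq># proots (char_poly A)"
  proof (rule two_roots_in_proots)
    show "char_poly A \<noteq> 0" using degree_monic_char_poly[OF A] n by auto
    show "poly (char_poly A) \<mu> = 0" using eigenvalue_of_function[OF A fnz] f(3) by blast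
    have "\<exists>i<n. w i \<noteq> 0" using w0[of 0] n by (intro exI[of _ 0]) auto
    then show "poly (char_poly A) \<rho> = 0" using eigenvalue_of_function[OF A] w by blast
    show "poly (pderiv (char_poly A)) \<rho> = 0" if "\<rho> = \<mu>"
      using double_root_char_poly[OF A fnz w0 ind] f(3) w that by blast
  qed
  then have "\<mu> \<le> rev (sorted_list_of_multiset (proots (char_poly A))) ! 1"
    using \<open>\<mu> \<le> \<rho>\<close> by (rule second_largest_ge)
  then have "\<mu> * (\<Sum>i<n. (h i)\<^sup>2) \<le> rev (sorted_list_of_multiset (proots (char_poly A))) ! 1 * (\<Sum>i<n. (h i)\<^sup>2)"
    by (rule mult_right_mono) (simp add: sum_nonneg)
  then show ?thesis using max[OF h] by linarith
qed

section \<open>The spectral gap and edge boundaries\<close>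

abbreviation degree_of :: "'a pair_pre_digraph \<Rightarrow> 'a \<Rightarrow> nat" where
  "degree_of G \<equiv> out_degree (with_proj G)"

lemma degree_of_eq_card: "degree_of G v = card {u. (v, u) \<in> parcs G}"
proof -
  have "out_arcs (with_proj G) v = Pair v ` {u. (v, u) \<in> parcs G}"
    by (auto simp: out_arcs_def)
  then show ?thesis by (simp add: out_degree_def card_image inj_on_def)
qed

lemma sum_over_arcs:
  fixes F :: "'a \<Rightarrow> 'a \<Rightarrow> real"
  assumes "pair_graph G"
  shows "(\<Sum>u\<in>pverts G. \<Sum>v\<in>pverts G. if (u, v) \<in> parcs G then F u v else 0)
    = (\<Sum>(u, v)\<in>parcs G. F u v)"
proof -
  interpret pair_graph G by fact
  have sub: "parcs G \<subseteq> pverts G \<times> pverts G" using in_arcsD1 in_arcsD2 by auto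
  have "(\<Sum>u\<in>pverts G. \<Sum>v\<in>pverts G. if (u, v) \<in> parcs G then F u v else 0)
     = (\<Sum>e\<in>pverts G \<times> pverts G. if e \<in> parcs G then case_prod F e else 0)"
    unfolding sum.cartesian_product by (intro sum.cong) auto
  also have "\<dots> = (\<Sum>e\<in>parcs G. case_prod F e)"
    using sub by (intro sum.mono_neutral_cong_right) auto
  finally show ?thesis .
qed

lemma sum_arcs_tail:
  fixes F :: "'a \<Rightarrow> real"
  assumes "pair_graph G"
  shows "(\<Sum>(u, v)\<in>parcs G. F u) = (\<Sum>v\<in>pverts G. real (degree_of G v) * F v)"
proof -
  interpret pair_graph G by fact
  have "(\<Sum>v\<in>pverts G. if (u, v) \<in> parcs G then F u else 0) = real (degree_of G u) * F u"
    for u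
  proof -
    have "{v \<in> pverts G. (u, v) \<in> parcs G} = {v. (u, v) \<in> parcs G}" using in_arcsD2 by auto
    then show ?thesis by (simp add: degree_of_eq_card flip: sum.inter_filter)
  qed
  then show ?thesis unfolding sum_over_arcs[OF assms, symmetric] by simp
qed

lemma sum_arcs_swap:
  assumes "pair_graph G"
  shows "(\<Sum>(u, v)\<in>parcs G. F v u) = (\<Sum>(u, v)\<in>parcs G. F u v)"
proof -
  interpret pair_graph G by fact
  have "bij_betw prod.swap (parcs G) (parcs G)"
    by (rule bij_betwI[of _ _ _ prod.swap]) (auto intro: arcs_symmetric)
  then have "(\<Sum>e\<in>parcs G. case_prod F (prod.swap e)) = (\<Sum>e\<in>parcs G. case_prod F e)"
    by (rule sum.reindex_bij_betw)
  then show ?thesis by (simp add: case_prod_unfold)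
qed

text \<open>
  If the degrees of adjacent vertices have the constant product \<open>c\<close>, then \<open>\<surd>deg\<close> is an eigenvector
  for \<open>\<surd>c\<close>. In terms of \<open>h = \<surd>deg \<cdot> g\<close>, the form \<open>\<surd>c |h|\<^sup>2 - \<langle>h, A h\<rangle>\<close> is \<open>\<surd>c / 2\<close> times the
  sum of \<open>(g u - g v)\<^sup>2\<close> over the arcs. This shows at once that \<open>\<surd>c\<close> is the largest eigenvalue and
  that the bound by the second eigenvalue has the claimed shape; the mean value condition on \<open>g\<close>
  is the orthogonality of \<open>h\<close> to \<open>\<surd>deg\<close>.
\<close>

lemma spectral_gap_inequality:
  fixes G :: "'a pair_pre_digraph" and c :: nat and g :: "'a \<Rightarrow> real"
  assumes G: "pair_graph G" and card: "card (pverts G) \<ge> 2"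
    and pos: "\<And>v. v \<in> pverts G \<Longrightarrow> degree_of G v > 0"
    and c: "\<And>u v. (u, v) \<in> parcs G \<Longrightarrow> degree_of G u * degree_of G v = c"
    and g: "(\<Sum>v\<in>pverts G. real (degree_of G v) * g v) = 0"
  shows "(sqrt c - nth_eigenvalue G 2) * (\<Sum>v\<in>pverts G. real (degree_of G v) * (g v)\<^sup>2)
    \<le> sqrt c / 2 * (\<Sum>(u, v)\<in>parcs G. (g u - g v)\<^sup>2)"
proof -
  interpret pair_graph G by fact
  define V where "V = pverts G"
  define d where "d v = real (degree_of G v)" for v
  define vs where "vs = (SOME vs. distinct vs \<and> set vs = pverts G)"
  have "\<exists>vs. distinct vs \<and> set vs = pverts G" using finite_distinct_list pair_finite_verts by metis
  then have vs: "distinct vs" "set vs = V" unfolding vs_def V_def by (metis (mono_tags, lifting) someI_ex)+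
  define n where "n = length vs"
  define A where "A = adjacency_matrix G vs"
  have n: "n \<ge> 2" using vs card distinct_card[of vs] by (simp add: n_def V_def)
  have dpos: "d v > 0" if "v \<in> V" for v using pos that by (simp add: d_def V_def)
  have vsV: "vs ! i \<in> V" if "i < n" for i using that vs n_def nth_mem by metis
  have reindex: "(\<Sum>i<n. F (vs ! i)) = (\<Sum>v\<in>V. F v)" for F :: "'a \<Rightarrow> real"
    using bij_betw_nth[OF vs(1), of "{..<n}" V] vs(2) by (intro sum.reindex_bij_betw) (simp add: n_def)
  define w where "w v = sqrt (d v)" for v
  have wpos: "w v > 0" if "v \<in> V" for v using dpos[OF that] by (simp add: w_def)
  have w2: "w v * w v = d v" for v by (simp add: w_def d_def)
  have ww: "w u * w v = sqrt c" if "(u, v) \<in> parcs G" for u v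
    using c[OF that] by (simp add: w_def d_def flip: real_sqrt_mult of_nat_mult)
  have Aij: "A $$ (i, j) = (if (vs ! i, vs ! j) \<in> parcs G then 1 else 0)" if "i < n" "j < n" for i j
    using that by (simp add: A_def adjacency_matrix_def n_def)
  have form: "(\<Sum>i<n. \<Sum>j<n. A $$ (i, j) * (w (vs ! i) * g (vs ! i)) * (w (vs ! j) * g (vs ! j)))
      = sqrt c * (\<Sum>v\<in>V. d v * (g v)\<^sup>2) - sqrt c / 2 * (\<Sum>(u, v)\<in>parcs G. (g u - g v)\<^sup>2)"
    for g :: "'a \<Rightarrow> real"
  proof -
    have "(\<Sum>i<n. \<Sum>j<n. A $$ (i, j) * (w (vs ! i) * g (vs ! i)) * (w (vs ! j) * g (vs ! j)))
      = (\<Sum>i<n. \<Sum>j<n. if (vs ! i, vs ! j) \<in> parcs G then sqrt c * (g (vs ! i) * g (vs ! j)) else 0)"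
      using Aij by (intro sum.cong) (auto simp: mult_ac simp flip: ww)
    also have "\<dots> = (\<Sum>i<n. \<Sum>v\<in>V. if (vs ! i, v) \<in> parcs G then sqrt c * (g (vs ! i) * g v) else 0)"
      by (intro sum.cong refl reindex)
    also have "\<dots> = (\<Sum>u\<in>V. \<Sum>v\<in>V. if (u, v) \<in> parcs G then sqrt c * (g u * g v) else 0)"
      by (rule reindex)
    also have "\<dots> = (\<Sum>(u, v)\<in>parcs G. sqrt c * (g u * g v))"
      unfolding V_def by (rule sum_over_arcs[OF G])
    also have "\<dots> = sqrt c * (\<Sum>(u, v)\<in>parcs G. g u * g v)"
      by (simp add: sum_distrib_left case_prod_unfold)
    finally have 1: "(\<Sum>i<n. \<Sum>j<n. A $$ (i, j) * (w (vs ! i) * g (vs ! i)) * (w (vs ! j) * g (vs ! j))) = \<dots>" .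
    have "(\<Sum>(u, v)\<in>parcs G. (g u - g v)\<^sup>2)
        = (\<Sum>(u, v)\<in>parcs G. (g u)\<^sup>2) + (\<Sum>(u, v)\<in>parcs G. (g v)\<^sup>2) - 2 * (\<Sum>(u, v)\<in>parcs G. g u * g v)"
      by (simp add: power2_diff case_prod_unfold sum.distrib sum_subtractf sum_distrib_left mult_ac)
    also have "(\<Sum>(u, v)\<in>parcs G. (g v)\<^sup>2) = (\<Sum>(u, v)\<in>parcs G. (g u)\<^sup>2)"
      using sum_arcs_swap[OF G, of "\<lambda>u v. (g u)\<^sup>2"] by simp
    also have "(\<Sum>(u, v)\<in>parcs G. (g u)\<^sup>2) = (\<Sum>v\<in>V. d v * (g v)\<^sup>2)"
      using sum_arcs_tail[OF G, of "\<lambda>u. (g u)\<^sup>2"] by (simp add: V_def d_def)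
    finally have 2: "(\<Sum>(u, v)\<in>parcs G. (g u - g v)\<^sup>2)
      = 2 * (\<Sum>v\<in>V. d v * (g v)\<^sup>2) - 2 * (\<Sum>(u, v)\<in>parcs G. g u * g v)" by simp
    show ?thesis unfolding 1 2 by (simp add: algebra_simps)
  qed
  have norm: "(\<Sum>i<n. (w (vs ! i) * g (vs ! i))\<^sup>2) = (\<Sum>v\<in>V. d v * (g v)\<^sup>2)" for g :: "'a \<Rightarrow> real"
    using reindex[of "\<lambda>v. (w v * g v)\<^sup>2"] by (simp add: power_mult_distrib power2_eq_square[of "w _"] w2)
  have "(\<Sum>i<n. \<Sum>j<n. A $$ (i, j) * (w (vs ! i) * g (vs ! i)) * (w (vs ! j) * g (vs ! j)))
    \<le> rev (sorted_list_of_multiset (proots (char_poly A))) ! 1 * (\<Sum>i<n. (w (vs ! i) * g (vs ! i))\<^sup>2)"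
  proof (rule rayleigh_le_second_eigenvalue[where \<rho> = "sqrt c" and w = "\<lambda>i. w (vs ! i)"])
    show "A \<in> carrier_mat n n" by (simp add: A_def adjacency_matrix_def n_def)
    show "A $$ (i, j) = A $$ (j, i)" if "i < n" "j < n" for i j
      using that arcs_symmetric by (auto simp: Aij)
    show "w (vs ! i) \<noteq> 0" if "i < n" for i using wpos[OF vsV[OF that]] by simp
    show "(\<Sum>j<n. A $$ (i, j) * w (vs ! j)) = sqrt c * w (vs ! i)" if i: "i < n" for i
    proof -
      define u where "u = vs ! i"
      have u: "w u > 0" using wpos vsV i by (simp add: u_def)
      have "(\<Sum>j<n. A $$ (i, j) * w (vs ! j)) = (\<Sum>j<n. if (u, vs ! j) \<in> parcs G then sqrt c / w u else 0)"
      proof (intro sum.cong refl)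
        fix j assume "j \<in> {..<n}"
        then show "A $$ (i, j) * w (vs ! j) = (if (u, vs ! j) \<in> parcs G then sqrt c / w u else 0)"
          using Aij[OF i, of j] ww[of u "vs ! j"] u by (auto simp: u_def field_simps)
      qed
      also have "\<dots> = (\<Sum>v\<in>V. if (u, v) \<in> parcs G then sqrt c / w u else 0)" by (rule reindex)
      also have "\<dots> = (\<Sum>v\<in>{v \<in> V. (u, v) \<in> parcs G}. sqrt c / w u)"
        by (rule sum.inter_filter[symmetric]) (simp add: V_def)
      also have "{v \<in> V. (u, v) \<in> parcs G} = {v. (u, v) \<in> parcs G}" using in_arcsD2 by (auto simp: V_def)
      also have "(\<Sum>v\<in>{v. (u, v) \<in> parcs G}. sqrt c / w u) = d u * (sqrt c / w u)"
        by (simp add: d_def degree_of_eq_card)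
      also have "\<dots> = sqrt c * w u" using u by (simp flip: w2)
      finally show ?thesis by (simp add: u_def)
    qed
    show "(\<Sum>i<n. \<Sum>j<n. A $$ (i, j) * h i * h j) \<le> sqrt c * (\<Sum>i<n. (h i)\<^sup>2)" for h
    proof -
      \<comment> \<open>Every vector has the form w g, as w has no zero entry. So the identity for the form applies to
        arbitrary vectors and bounds the largest eigenvalue.\<close>
      define g' where "g' v = h (the_inv_into {..<n} ((!) vs) v) / w v" for v
      have inj: "inj_on ((!) vs) {..<n}" using vs(1) by (simp add: inj_on_nth n_def)
      have hg: "w (vs ! i) * g' (vs ! i) = h i" if "i < n" for i
        using that wpos[OF vsV[OF that]] the_inv_into_f_f[OF inj, of i] by (simp add: g'_def)
      have "(\<Sum>i<n. \<Sum>j<n. A $$ (i, j) * h i * h j)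
        = (\<Sum>i<n. \<Sum>j<n. A $$ (i, j) * (w (vs ! i) * g' (vs ! i)) * (w (vs ! j) * g' (vs ! j)))"
        using hg by (intro sum.cong) auto
      also have "\<dots> \<le> sqrt c * (\<Sum>v\<in>V. d v * (g' v)\<^sup>2)"
        unfolding form by (simp add: sum_nonneg case_prod_unfold)
      also have "\<dots> = sqrt c * (\<Sum>i<n. (h i)\<^sup>2)"
        using hg unfolding norm[symmetric] by simp
      finally show ?thesis .
    qed
    have "(\<Sum>i<n. w (vs ! i) * g (vs ! i) * w (vs ! i)) = (\<Sum>v\<in>V. w v * g v * w v)"
      by (rule reindex)
    also have "\<dots> = (\<Sum>v\<in>V. d v * g v)" by (intro sum.cong) (auto simp: mult_ac simp flip: w2)
    finally show "(\<Sum>i<n. w (vs ! i) * g (vs ! i) * w (vs ! i)) = 0" using g by (simp add: d_def V_def)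
  qed (rule n)
  then have "sqrt c * (\<Sum>v\<in>V. d v * (g v)\<^sup>2) - sqrt c / 2 * (\<Sum>(u, v)\<in>parcs G. (g u - g v)\<^sup>2)
      \<le> nth_eigenvalue G 2 * (\<Sum>v\<in>V. d v * (g v)\<^sup>2)"
    unfolding form norm by (simp add: nth_eigenvalue_def eigenvalue_list_def A_def vs_def)
  then show ?thesis by (simp add: V_def d_def algebra_simps)
qed

definition arcs_between :: "'a pair_pre_digraph \<Rightarrow> 'a set \<Rightarrow> 'a set \<Rightarrow> nat" where
  "arcs_between G A B = card (parcs G \<inter> A \<times> B)"

definition volume :: "'a pair_pre_digraph \<Rightarrow> 'a set \<Rightarrow> nat" where
  "volume G A = (\<Sum>v\<in>A. degree_of G v)"

lemma volume_pos:
  assumes "pair_graph G" and pos: "\<And>v. v \<in> pverts G \<Longrightarrow> degree_of G v > 0"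
    and S: "S \<subseteq> pverts G" "S \<noteq> {}"
  shows "volume G S > 0"
proof -
  interpret pair_graph G by fact
  show ?thesis unfolding volume_def
  proof (rule sum_pos)
    show "finite S" using S(1) by (rule finite_subset) simp
    show "0 < degree_of G v" if "v \<in> S" for v using that S(1) by (intro pos) blast
  qed fact
qed

lemma sum_arcs_indicator:
  assumes "pair_graph G"
  shows "(\<Sum>(u, v)\<in>parcs G. of_bool (u \<in> A \<and> v \<in> B)) = real (arcs_between G A B)"
proof -
  interpret pair_graph G by fact
  have "{e \<in> parcs G. fst e \<in> A \<and> snd e \<in> B} = parcs G \<inter> A \<times> B" by auto
  then show ?thesis by (simp add: arcs_between_def case_prod_unfold of_bool_def flip: sum.inter_filter)
qed

text \<open>
  The spectral gap inequality is applied to the function with value \<open>1 / vol A\<close> on \<open>A\<close> and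
  \<open>- 1 / vol B\<close> on \<open>B\<close>, which has weighted mean zero.
\<close>

lemma spectral_gap_le_two_boundaries:
  fixes G :: "'a pair_pre_digraph" and c :: nat
  assumes G: "pair_graph G"
    and pos: "\<And>v. v \<in> pverts G \<Longrightarrow> degree_of G v > 0"
    and c: "\<And>u v. (u, v) \<in> parcs G \<Longrightarrow> degree_of G u * degree_of G v = c"
    and A: "A \<subseteq> pverts G" "A \<noteq> {}" and B: "B \<subseteq> pverts G" "B \<noteq> {}" and AB: "A \<inter> B = {}"
  shows "(sqrt c - nth_eigenvalue G 2) * (1 / volume G A + 1 / volume G B)
    \<le> sqrt c * (arcs_between G A (pverts G - A) / (volume G A)\<^sup>2
       + arcs_between G B (pverts G - B) / (volume G B)\<^sup>2
       + 2 * arcs_between G A B / (volume G A * volume G B))"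
proof -
  interpret pair_graph G by fact
  define V where "V = pverts G"
  define p q where "p = 1 / real (volume G A)" and "q = 1 / real (volume G B)"
  have fin: "finite V" "finite A" "finite B" using finite_subset[OF A(1)] finite_subset[OF B(1)] by (auto simp: V_def)
  have vol: "p * volume G A = 1" "q * volume G B = 1"
    using volume_pos[OF G pos A] volume_pos[OF G pos B] by (auto simp: p_def q_def)
  define g where "g v = p * of_bool (v \<in> A) - q * of_bool (v \<in> B)" for v
  have ind: "(\<Sum>v\<in>V. real (degree_of G v) * of_bool (v \<in> S)) = volume G S" if "S \<subseteq> V" for S
  proof -
    have "(\<Sum>v\<in>V. real (degree_of G v) * of_bool (v \<in> S)) = (\<Sum>v\<in>S. real (degree_of G v))"
      using that fin by (intro sum.mono_neutral_cong_right) auto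
    then show ?thesis by (simp add: volume_def)
  qed
  have lin: "(\<Sum>v\<in>V. real (degree_of G v) * (r * of_bool (v \<in> A) + s * of_bool (v \<in> B)))
      = r * volume G A + s * volume G B" for r s
  proof -
    have "(\<Sum>v\<in>V. real (degree_of G v) * (r * of_bool (v \<in> A) + s * of_bool (v \<in> B)))
      = r * (\<Sum>v\<in>V. real (degree_of G v) * of_bool (v \<in> A))
        + s * (\<Sum>v\<in>V. real (degree_of G v) * of_bool (v \<in> B))"
      by (simp add: distrib_left sum.distrib sum_distrib_left mult_ac)
    then show ?thesis using ind A B by (simp add: V_def)
  qed
  have g0: "(\<Sum>v\<in>V. real (degree_of G v) * g v) = 0"
    using lin[of p "-q"] vol by (simp add: g_def)
  have "(g v)\<^sup>2 = p\<^sup>2 * of_bool (v \<in> A) + q\<^sup>2 * of_bool (v \<in> B)" for v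
    using AB by (auto simp: g_def)
  then have "(\<Sum>v\<in>V. real (degree_of G v) * (g v)\<^sup>2) = p\<^sup>2 * volume G A + q\<^sup>2 * volume G B"
    using lin[of "p\<^sup>2" "q\<^sup>2"] by simp
  also have "\<dots> = p * (p * volume G A) + q * (q * volume G B)" by (simp add: power2_eq_square)
  finally have g2: "(\<Sum>v\<in>V. real (degree_of G v) * (g v)\<^sup>2) = p + q" using vol by simp
  \<comment> \<open>Indicator of the arcs from S to T; both orientations of an arc occur in the sum.\<close>
  define on where "on S T u v = (of_bool (u \<in> S \<and> v \<in> T) :: real)" for S T and u v :: 'a
  have on: "(\<Sum>e\<in>parcs G. on S T (fst e) (snd e)) = arcs_between G S T"
    and on': "(\<Sum>e\<in>parcs G. on S T (snd e) (fst e)) = arcs_between G S T" for S T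
    using sum_arcs_indicator[OF G, of S T] sum_arcs_swap[OF G, of "on S T"]
    by (simp_all add: on_def case_prod_unfold)
  have square: "(g u - g v)\<^sup>2 = p\<^sup>2 * on A (V - A) u v + p\<^sup>2 * on A (V - A) v u
      + q\<^sup>2 * on B (V - B) u v + q\<^sup>2 * on B (V - B) v u
      + 2 * p * q * on A B u v + 2 * p * q * on A B v u"
    if "u \<in> V" "v \<in> V" for u v
  proof -
    have "u \<notin> A \<or> u \<notin> B" "v \<notin> A \<or> v \<notin> B" using AB by auto
    then show ?thesis using that unfolding g_def on_def
      by (cases "u \<in> A"; cases "u \<in> B"; cases "v \<in> A"; cases "v \<in> B")
        (simp_all add: power2_eq_square algebra_simps)
  qed
  have "(\<Sum>(u, v)\<in>parcs G. (g u - g v)\<^sup>2) = (\<Sum>e\<in>parcs G.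
        p\<^sup>2 * on A (V - A) (fst e) (snd e) + p\<^sup>2 * on A (V - A) (snd e) (fst e)
      + q\<^sup>2 * on B (V - B) (fst e) (snd e) + q\<^sup>2 * on B (V - B) (snd e) (fst e)
      + 2 * p * q * on A B (fst e) (snd e) + 2 * p * q * on A B (snd e) (fst e))"
    unfolding case_prod_unfold using in_arcsD1 in_arcsD2
    by (intro sum.cong square) (auto simp: V_def)
  also have "\<dots> = 2 * (p\<^sup>2 * arcs_between G A (V - A) + q\<^sup>2 * arcs_between G B (V - B)
      + 2 * p * q * arcs_between G A B)"
    unfolding sum.distrib sum_distrib_left[symmetric] on on' by (simp add: algebra_simps)
  finally have en: "(\<Sum>(u, v)\<in>parcs G. (g u - g v)\<^sup>2) = \<dots>" .
  have "card V \<ge> 2"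
  proof -
    obtain x y where "x \<in> A" "y \<in> B" "x \<noteq> y" using A B AB by blast
    then have "card {x, y} \<le> card V" using A B fin by (intro card_mono) (auto simp: V_def)
    then show ?thesis using \<open>x \<noteq> y\<close> by simp
  qed
  from spectral_gap_inequality[OF G this[unfolded V_def] pos c g0[unfolded V_def]]
  have "(sqrt c - nth_eigenvalue G 2) * (p + q) \<le> sqrt c / 2 *
      (2 * (p\<^sup>2 * arcs_between G A (V - A) + q\<^sup>2 * arcs_between G B (V - B) + 2 * p * q * arcs_between G A B))"
    unfolding V_def[symmetric] g2 en .
  also have "\<dots> = sqrt c * (p\<^sup>2 * arcs_between G A (V - A) + q\<^sup>2 * arcs_between G B (V - B) + 2 * p * q * arcs_between G A B)"
    by simp
  finally have "(sqrt c - nth_eigenvalue G 2) * (p + q) \<le> \<dots>" .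
  then show ?thesis by (simp add: p_def q_def V_def power_divide)
qed

text \<open>
  If both inequalities failed, adding them with the weights \<open>1 / (vol A)\<^sup>2\<close> and \<open>1 / (vol B)\<^sup>2\<close> would
  contradict the previous lemma, because \<open>2 / (vol A \<cdot> vol B) \<le> 1 / (vol A)\<^sup>2 + 1 / (vol B)\<^sup>2\<close>.
\<close>

lemma large_boundary_of_disjoint_sets:
  fixes G :: "'a pair_pre_digraph" and c :: nat
  assumes G: "pair_graph G"
    and pos: "\<And>v. v \<in> pverts G \<Longrightarrow> degree_of G v > 0"
    and c: "\<And>u v. (u, v) \<in> parcs G \<Longrightarrow> degree_of G u * degree_of G v = c"
    and A: "A \<subseteq> pverts G" "A \<noteq> {}" and B: "B \<subseteq> pverts G" "B \<noteq> {}" and AB: "A \<inter> B = {}"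
  shows "(sqrt c - nth_eigenvalue G 2) * volume G A
        \<le> sqrt c * (arcs_between G A (pverts G - A) + arcs_between G A B)
    \<or> (sqrt c - nth_eigenvalue G 2) * volume G B
        \<le> sqrt c * (arcs_between G B (pverts G - B) + arcs_between G A B)"
proof (rule ccontr)
  interpret pair_graph G by fact
  define \<gamma> where "\<gamma> = sqrt c - nth_eigenvalue G 2"
  define x y where "x = real (volume G A)" and "y = real (volume G B)"
  define d d' e where "d = real (arcs_between G A (pverts G - A))"
    and "d' = real (arcs_between G B (pverts G - B))" and "e = real (arcs_between G A B)"
  define s where "s = sqrt c"
  have xy: "x > 0" "y > 0"
    using volume_pos[OF G pos A] volume_pos[OF G pos B] by (auto simp: x_def y_def)
  assume "\<not> ?thesis"
  then have less: "s * (d + e) < \<gamma> * x" "s * (d' + e) < \<gamma> * y"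
    by (auto simp: \<gamma>_def x_def y_def d_def d'_def e_def s_def)
  have "s * (d + e) * y\<^sup>2 < \<gamma> * x * y\<^sup>2" "s * (d' + e) * x\<^sup>2 < \<gamma> * y * x\<^sup>2"
    using less xy by (auto intro: mult_strict_right_mono)
  moreover have "\<gamma> * (1 / x + 1 / y) \<le> s * (d / x\<^sup>2 + d' / y\<^sup>2 + 2 * e / (x * y))"
    using spectral_gap_le_two_boundaries[OF G pos c A B AB]
    by (simp add: \<gamma>_def x_def y_def d_def d'_def e_def s_def)
  then have "\<gamma> * (1 / x + 1 / y) * (x\<^sup>2 * y\<^sup>2) \<le> s * (d / x\<^sup>2 + d' / y\<^sup>2 + 2 * e / (x * y)) * (x\<^sup>2 * y\<^sup>2)"
    by (rule mult_right_mono) simp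
  moreover have "\<gamma> * (1 / x + 1 / y) * (x\<^sup>2 * y\<^sup>2) = \<gamma> * x * y\<^sup>2 + \<gamma> * y * x\<^sup>2"
    using xy by (simp add: field_simps power2_eq_square)
  moreover have "s * (d / x\<^sup>2 + d' / y\<^sup>2 + 2 * e / (x * y)) * (x\<^sup>2 * y\<^sup>2)
      = s * (d * y\<^sup>2 + d' * x\<^sup>2 + 2 * e * x * y)"
    using xy by (simp add: field_simps power2_eq_square)
  moreover have "0 \<le> s * (e * (x - y)\<^sup>2)" by (simp add: s_def e_def)
  ultimately show False by (simp add: algebra_simps power2_eq_square)
qed

section \<open>Rigidity rank and 2-connectedness\<close>

text \<open>
  The largest number of edges of a graph without redundant edges, in the sense of generic rigidity in
  the plane, on the vertices that are covered by \<open>F\<close>. Its Dilworth truncation is the rank function of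
  the two-dimensional generic rigidity matroid.
\<close>

definition laman_bound :: "'a set set \<Rightarrow> nat" where
  "laman_bound F = 2 * card (\<Union>F) - 3"

abbreviation rigidity_rank :: "'a set set \<Rightarrow> nat" where
  "rigidity_rank \<equiv> dilworth_truncation laman_bound"

lemma laman_bound_le:
  assumes "\<Union>F \<subseteq> X" "finite X"
  shows "laman_bound F \<le> 2 * card X - 3"
  using card_mono[OF assms(2,1)] by (simp add: laman_bound_def)

lemma laman_bound_mono: "F \<subseteq> G \<Longrightarrow> finite (\<Union>G) \<Longrightarrow> laman_bound F \<le> laman_bound G"
  using laman_bound_le[of F "\<Union>G"] by (auto simp: laman_bound_def)

lemma card_Union_edges_ge:
  assumes "F \<noteq> {}" "finite (\<Union>F)" "\<And>e. e \<in> F \<Longrightarrow> card e = 2"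
  shows "card (\<Union>F) \<ge> 2"
proof -
  obtain e where "e \<in> F" using assms(1) by blast
  then show ?thesis using card_mono[OF assms(2), of e] assms(3)[of e] by auto
qed

text \<open>
  The intersection of the covered vertex sets contains the vertices covered by the intersection, which
  are at least two as soon as \<open>A\<close> and \<open>B\<close> have a common edge; so none of the four natural number
  subtractions is truncated.
\<close>

lemma intersecting_submodular_laman_bound:
  assumes fin: "finite (\<Union>E)" and two: "\<And>e. e \<in> E \<Longrightarrow> card e = 2"
  shows "intersecting_submodular E laman_bound"
  unfolding intersecting_submodular_def
proof (intro allI impI)
  fix A B assume AB: "A \<subseteq> E" "B \<subseteq> E" "A \<inter> B \<noteq> {}"
  have finU: "finite (\<Union>A)" "finite (\<Union>B)" using AB fin by (meson Union_mono finite_subset)+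
  have "\<Union>(A \<inter> B) \<subseteq> \<Union>A \<inter> \<Union>B" by blast
  then have "card (\<Union>(A \<inter> B)) \<le> card (\<Union>A \<inter> \<Union>B)" using finU by (intro card_mono) auto
  moreover have "card (\<Union>A) + card (\<Union>B) = card (\<Union>(A \<union> B)) + card (\<Union>A \<inter> \<Union>B)"
    using card_Un_Int[OF finU] by (simp add: Union_Un_distrib)
  moreover have "card (\<Union>(A \<inter> B)) \<ge> 2"
  proof (rule card_Union_edges_ge)
    show "finite (\<Union>(A \<inter> B))" using finU(1) by (rule finite_subset[rotated]) blast
  qed (use AB two in auto)
  moreover have "card (\<Union>A \<inter> \<Union>B) \<le> card (\<Union>A)" "card (\<Union>A \<inter> \<Union>B) \<le> card (\<Union>B)"
    using finU by (auto intro: card_mono)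
  ultimately show "laman_bound (A \<union> B) + laman_bound (A \<inter> B) \<le> laman_bound A + laman_bound B"
    unfolding laman_bound_def by linarith
qed

definition edge_graph :: "'a set \<Rightarrow> 'a set set \<Rightarrow> 'a pair_pre_digraph" where
  "edge_graph V T = \<lparr>pverts = V, parcs = {(u, v). {u, v} \<in> T}\<rparr>"

lemma edge_graph_simps [simp]:
  "pverts (edge_graph V T) = V" "(u, v) \<in> parcs (edge_graph V T) \<longleftrightarrow> {u, v} \<in> T"
  by (auto simp: edge_graph_def)

lemma pair_graph_edge_graph:
  assumes "finite V" "\<And>e. e \<in> T \<Longrightarrow> e \<subseteq> V \<and> card e = 2"
  shows "pair_graph (edge_graph V T)"
proof
  have "parcs (edge_graph V T) \<subseteq> V \<times> V" using assms(2) by fastforce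
  then show "finite (parcs (edge_graph V T))" using assms(1) by (meson finite_SigmaI finite_subset)
  show "symmetric (with_proj (edge_graph V T))"
    by (auto simp: symmetric_def arcs_ends_conv sym_def insert_commute)
  show "fst e \<noteq> snd e" if "e \<in> parcs (edge_graph V T)" for e
    using that assms(2)[of "{fst e, snd e}"] by (cases e) auto
  show "fst e \<in> pverts (edge_graph V T)" "snd e \<in> pverts (edge_graph V T)"
    if "e \<in> parcs (edge_graph V T)" for e
    using that assms(2)[of "{fst e, snd e}"] by (cases e; auto)+
qed (use assms in auto)

lemma disconnected_edge_graph_split:
  assumes "disconnected (with_proj (edge_graph V T) \<restriction> W)" "finite V" "W \<subseteq> V"
    and T: "\<And>e. e \<in> T \<Longrightarrow> e \<subseteq> V \<and> card e = 2"
  obtains C D where "C \<union> D = W" "C \<inter> D = {}" "C \<noteq> {}" "D \<noteq> {}"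
    "\<And>x y. x \<in> C \<Longrightarrow> y \<in> D \<Longrightarrow> {x, y} \<notin> T"
proof -
  interpret H: pair_graph "edge_graph V T" using assms(2) T by (rule pair_graph_edge_graph)
  define K where "K = with_proj (edge_graph V T) \<restriction> W"
  define M where "M = mk_symmetric K"
  interpret K: wf_digraph K unfolding K_def by (rule H.wellformed_induce_subgraph)
  interpret M: pair_wf_digraph M unfolding M_def by (rule K.wellformed_mk_symmetric)
  have vM: "pverts M = W" by (simp add: M_def K_def)
  have arcM: "(x, y) \<in> parcs M" if "x \<in> W" "y \<in> W" "{x, y} \<in> T" for x y
    using that by (auto simp: M_def K_def parcs_mk_symmetric intro!: bexI[of _ "(x, y)"])
  obtain u v where uv: "u \<in> W" "v \<in> W" "\<not> u \<rightarrow>\<^sup>*\<^bsub>with_proj M\<^esub> v"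
    using assms(1) unfolding disconnected_def Digraph_Component.connected_def strongly_connected_def
    by (auto simp: K_def M_def)
  define C where "C = {x \<in> W. u \<rightarrow>\<^sup>*\<^bsub>with_proj M\<^esub> x}"
  show thesis
  proof (rule that)
    show "C \<union> (W - C) = W" "C \<inter> (W - C) = {}" by (auto simp: C_def)
    show "W - C \<noteq> {}" using uv by (auto simp: C_def)
    have "u \<in> C" using uv(1) vM M.reachable_refl[of u] by (simp add: C_def)
    then show "C \<noteq> {}" by blast
    fix x y assume x: "x \<in> C" and y: "y \<in> W - C"
    show "{x, y} \<notin> T"
    proof
      assume "{x, y} \<in> T"
      then have "(x, y) \<in> parcs M" using x y by (intro arcM) (auto simp: C_def)
      then have "x \<rightarrow>\<^bsub>with_proj M\<^esub> y" by simp
      then have "u \<rightarrow>\<^sup>*\<^bsub>with_proj M\<^esub> y" using x by (auto simp: C_def intro: M.reachable_adj_trans)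
      then show False using y by (simp add: C_def)
    qed
  qed
qed

text \<open>
  Let \<open>S\<close> be a separating set with at most one vertex, and let \<open>C\<close> and \<open>D\<close> be the two sides. Each
  edge lies within \<open>C \<union> S\<close> or within \<open>D \<union> S\<close>, and these sets have at most \<open>n + 1\<close> vertices in
  total. So the rank is at most \<open>2 (n + 1) - 6 = 2 n - 4\<close> if both have at least two vertices, and
  at most \<open>2 (n - 1) - 3\<close> if one is a single vertex.
\<close>

lemma two_connected_of_full_rank:
  assumes V: "finite V" "card V \<ge> 3"
    and T: "\<And>e. e \<in> T \<Longrightarrow> e \<subseteq> V \<and> card e = 2"
    and rank: "rigidity_rank T \<ge> 2 * card V - 3"
  shows "two_connected (edge_graph V T)"
proof -
  have finT: "finite T" using T V(1) by (meson PowI finite_Pow_iff finite_subset subsetI)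
  have key: "card S \<ge> 2" if sep: "separating_set (edge_graph V T) S" for S
  proof (rule ccontr)
    assume S1: "\<not> 2 \<le> card S"
    have SV: "S \<subseteq> V" and dis: "disconnected (with_proj (edge_graph V T) \<restriction> (V - S))"
      using sep by (auto simp: separating_set_def)
    have finS: "finite S" using SV V(1) finite_subset by blast
    obtain C D where CD: "C \<union> D = V - S" "C \<inter> D = {}" "C \<noteq> {}" "D \<noteq> {}"
      and none: "\<And>x y. x \<in> C \<Longrightarrow> y \<in> D \<Longrightarrow> {x, y} \<notin> T"
      using disconnected_edge_graph_split[OF dis V(1) _ T] by auto
    have fin: "finite C" "finite D" using CD(1) V(1) by (metis finite_Diff finite_Un)+
    define T1 T2 where "T1 = {e \<in> T. e \<subseteq> C \<union> S}" and "T2 = {e \<in> T. e \<subseteq> D \<union> S}"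
    have "T \<subseteq> T1 \<union> T2"
    proof
      fix e assume e: "e \<in> T"
      then obtain x y where xy: "e = {x, y}" using T by (meson card_2_iff)
      have "x \<in> C \<union> D \<union> S" "y \<in> C \<union> D \<union> S" using T[OF e] xy CD(1) by auto
      then show "e \<in> T1 \<union> T2"
        using e none[of x y] none[of y x] unfolding xy T1_def T2_def by (auto simp: insert_commute)
    qed
    moreover have "T1 \<inter> T2 = {}"
    proof -
      have False if "e \<in> T1" "e \<in> T2" for e
      proof -
        have "e \<subseteq> S" using that CD(2) by (auto simp: T1_def T2_def)
        then have "card e \<le> card S" using finS by (rule card_mono[rotated])
        then show False using that S1 T[of e] by (auto simp: T1_def)
      qed
      then show ?thesis by blast
    qed
    ultimately have "rigidity_rank T \<le> rigidity_rank T1 + rigidity_rank T2"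
      using dilworth_truncation_Un_le[of T1 T2 laman_bound] finT
      by (metis (no_types, lifting) T1_def T2_def Un_subset_iff finite_subset mem_Collect_eq subsetI subset_antisym)
    also have "\<dots> \<le> laman_bound T1 + laman_bound T2"
      by (intro add_mono dilworth_truncation_le_self)
    also have "\<dots> \<le> (2 * card (C \<union> S) - 3) + (2 * card (D \<union> S) - 3)"
      using fin finS by (intro add_mono laman_bound_le) (auto simp: T1_def T2_def)
    finally have "2 * card V - 3 \<le> (2 * card (C \<union> S) - 3) + (2 * card (D \<union> S) - 3)"
      using rank by simp
    moreover have "card (C \<union> S) = card C + card S" "card (D \<union> S) = card D + card S"
      using CD fin finS by (auto intro!: card_Un_disjoint)
    moreover have "card V = card C + card D + card S"
    proof -
      have "V = (C \<union> D) \<union> S" "(C \<union> D) \<inter> S = {}" using CD(1) SV by auto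
      then have "card V = card (C \<union> D) + card S" using fin finS card_Un_disjoint by (metis finite_Un)
      then show ?thesis using CD(2) fin card_Un_disjoint by metis
    qed
    moreover have "card C \<ge> 1" "card D \<ge> 1" using fin CD by (auto simp: Suc_le_eq card_gt_0_iff)
    ultimately show False using S1 V(2) by linarith
  qed
  show ?thesis
  proof (cases "\<exists>S. separating_set (edge_graph V T) S")
    case True
    define m where "m = (LEAST m. \<exists>S. separating_set (edge_graph V T) S \<and> card S = m)"
    have "\<exists>m S. separating_set (edge_graph V T) S \<and> card S = m" using True by blast
    then have "\<exists>S. separating_set (edge_graph V T) S \<and> card S = m" unfolding m_def by (rule LeastI_ex)
    then have "m \<ge> 2" using key by blast
    then show ?thesis using True by (simp add: two_connected_def vertex_connectivity_def m_def)
  next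
    case False
    then show ?thesis using V by (simp add: two_connected_def vertex_connectivity_def)
  qed
qed

section \<open>Discharging\<close>

lemma sum_double_count:
  fixes w :: "'a \<Rightarrow> nat"
  assumes "finite I" "finite V" "\<And>i. i \<in> I \<Longrightarrow> X i \<subseteq> V"
  shows "(\<Sum>i\<in>I. \<Sum>v\<in>X i. w v) = (\<Sum>v\<in>V. card {i \<in> I. v \<in> X i} * w v)"
proof -
  have "(\<Sum>i\<in>I. \<Sum>v\<in>X i. w v) = (\<Sum>i\<in>I. \<Sum>v\<in>{v \<in> V. v \<in> X i}. w v)"
    using assms(3) by (intro sum.cong) auto
  also have "\<dots> = (\<Sum>v\<in>V. \<Sum>i\<in>{i \<in> I. v \<in> X i}. w v)"
    by (rule sum.swap_restrict[OF assms(1,2)])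
  finally show ?thesis by simp
qed

lemma card_arcs_by_tail:
  assumes "finite U" "finite S"
  shows "card (U \<inter> S \<times> UNIV) = (\<Sum>v\<in>S. card {u. (v, u) \<in> U})"
proof -
  have "U \<inter> S \<times> UNIV = (\<Union>v\<in>S. Pair v ` {u. (v, u) \<in> U})" by auto
  also have "card \<dots> = (\<Sum>v\<in>S. card (Pair v ` {u. (v, u) \<in> U}))"
  proof (rule card_UN_disjoint[OF assms(2)])
    have "Pair v ` {u. (v, u) \<in> U} \<subseteq> U" for v by auto
    then show "\<forall>v\<in>S. finite (Pair v ` {u. (v, u) \<in> U})" using assms(1) finite_subset by metis
  qed auto
  finally show ?thesis by (simp add: card_image inj_on_def)
qed

text \<open>
  The quantity on the left is the charge of \<open>X\<close> in the discharging argument, where \<open>A\<close> consists of the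
  vertices that belong to \<open>X\<close> alone. It implies \<open>card (X - A) \<le> 2\<close>.
\<close>

definition weakly_attached :: "'a pair_pre_digraph \<Rightarrow> nat \<Rightarrow> 'a set \<Rightarrow> 'a set \<Rightarrow> bool" where
  "weakly_attached G k X A \<longleftrightarrow> A \<noteq> {} \<and> A \<subseteq> X \<and> X \<subseteq> pverts G \<and>
     2 * k * card (X - A) + arcs_between G A (pverts G - X) < 6 * k"

text \<open>
  Let \<open>m v\<close> be the number of the sets that contain \<open>v\<close>, and \<open>d\<^sub>U v\<close> the number of uncovered arcs
  that leave \<open>v\<close>. The right-hand side exceeds \<open>4 k n\<close> by the sum of
  \<open>d\<^sub>U v + 4 k (m v - 1)\<close> over all vertices and by \<open>6 k\<close>. A vertex with \<open>m v = 0\<close> has only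
  uncovered arcs, so its term is not negative. A vertex with \<open>m v \<ge> 2\<close> has a term of at least
  \<open>2 k m v\<close> and gives \<open>2 k\<close> to each set containing it; a vertex with \<open>m v = 1\<close> gives \<open>d\<^sub>U v\<close> to its
  only set. A set that receives less than \<open>6 k\<close> is weakly attached, and there is at most one of these.
\<close>

lemma discharging:
  fixes G :: "'a pair_pre_digraph" and X :: "'i \<Rightarrow> 'a set"
  assumes G: "pair_graph G" and deg: "\<And>v. v \<in> pverts G \<Longrightarrow> degree_of G v \<ge> 4 * k"
    and I: "finite I" "\<And>i. i \<in> I \<Longrightarrow> X i \<subseteq> pverts G" "\<And>i. i \<in> I \<Longrightarrow> card (X i) \<ge> 3"
    and weak: "\<And>X A Y B. weakly_attached G k X A \<Longrightarrow> weakly_attached G k Y B \<Longrightarrow>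
      A \<inter> Y = {} \<Longrightarrow> B \<inter> X = {} \<Longrightarrow> False"
  shows "4 * k * card (pverts G) + 6 * k * card I \<le>
    card {(u, v) \<in> parcs G. \<forall>i\<in>I. \<not> (u \<in> X i \<and> v \<in> X i)} + 4 * k * (\<Sum>i\<in>I. card (X i)) + 6 * k"
proof -
  interpret pair_graph G by fact
  define V where "V = pverts G"
  define U where "U = {(u, v) \<in> parcs G. \<forall>i\<in>I. \<not> (u \<in> X i \<and> v \<in> X i)}"
  define m where "m v = card {i \<in> I. v \<in> X i}" for v
  define A where "A i = {v \<in> X i. m v = 1}" for i
  define dU where "dU v = card {u. (v, u) \<in> U}" for v
  define h where "h i = 2 * k * card (X i - A i) + arcs_between G (A i) (V - X i)" for i
  have finV: "finite V" by (simp add: V_def)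
  have XV: "X i \<subseteq> V" if "i \<in> I" for i using I(2) that by (simp add: V_def)
  have finX: "finite (X i)" if "i \<in> I" for i using XV[OF that] finV finite_subset by blast
  have finU: "finite U" unfolding U_def by (rule finite_subset[of _ "parcs G"]) auto
  have only: "j = i" if "v \<in> A i" "v \<in> X j" "i \<in> I" "j \<in> I" for v i j
  proof -
    have "card {i \<in> I. v \<in> X i} = 1" using that(1) by (simp add: A_def m_def)
    then obtain l where "{i \<in> I. v \<in> X i} = {l}" by (auto simp: card_1_singleton_iff)
    moreover have "i \<in> {i \<in> I. v \<in> X i}" "j \<in> {i \<in> I. v \<in> X i}" using that by (auto simp: A_def)
    ultimately show ?thesis by (metis singletonD)
  qed
  have "U \<subseteq> V \<times> UNIV" using in_arcsD1 by (auto simp: U_def V_def)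
  then have cardU: "card U = (\<Sum>v\<in>V. dU v)"
    using card_arcs_by_tail[OF finU finV] by (simp add: dU_def Int_absorb2)
  have arcsA: "arcs_between G (A i) (V - X i) \<le> (\<Sum>v\<in>A i. dU v)" if i: "i \<in> I" for i
  proof -
    have "finite (A i)" using finX[OF i] by (simp add: A_def)
    moreover have "parcs G \<inter> A i \<times> (V - X i) \<subseteq> U \<inter> A i \<times> UNIV"
      using only[OF _ _ i] by (fastforce simp: U_def)
    then have "card (parcs G \<inter> A i \<times> (V - X i)) \<le> card (U \<inter> A i \<times> UNIV)"
      using finU by (intro card_mono) auto
    ultimately show ?thesis
      using card_arcs_by_tail[OF finU] by (simp add: arcs_between_def dU_def)
  qed
  have "6 * k * card I \<le> (\<Sum>i\<in>I. h i) + 6 * k"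
  proof (cases "\<exists>i\<in>I. h i < 6 * k")
    case True
    then obtain i where i: "i \<in> I" "h i < 6 * k" by blast
    have bad: "weakly_attached G k (X j) (A j)" if "j \<in> I" "h j < 6 * k" for j
    proof -
      have "2 * k * card (X j - A j) < 2 * k * 3" using that(2) unfolding h_def by linarith
      then have "card (X j - A j) < 3" unfolding nat_mult_less_cancel_disj by blast
      moreover have "X j - A j = X j" if "A j = {}" using that by simp
      ultimately have "A j \<noteq> {}" using I(3)[OF that(1)] by fastforce
      then show ?thesis using that XV by (auto simp: weakly_attached_def h_def V_def A_def)
    qed
    have other: "6 * k \<le> h j" if j: "j \<in> I - {i}" for j
    proof (rule ccontr)
      assume "\<not> 6 * k \<le> h j"
      then have "weakly_attached G k (X j) (A j)" using bad j by simp
      moreover have "A i \<inter> X j = {}" "A j \<inter> X i = {}" using only i j by blast+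
      ultimately show False using weak[OF bad[OF i]] by blast
    qed
    have "6 * k * card (I - {i}) \<le> (\<Sum>j\<in>I - {i}. h j)"
      using sum_bounded_below[of "I - {i}" "6 * k" h] other by (simp add: mult.commute)
    also have "\<dots> \<le> (\<Sum>j\<in>I. h j)" using I(1) by (intro sum_mono2) auto
    finally have "6 * k * card (I - {i}) \<le> (\<Sum>j\<in>I. h j)" .
    moreover have "card I = Suc (card (I - {i}))" using I(1) i(1) by (rule card.remove)
    ultimately show ?thesis by simp
  next
    case False
    then have "6 * k * card I \<le> (\<Sum>j\<in>I. h j)"
      using sum_bounded_below[of I "6 * k" h] by (force simp: mult.commute)
    then show ?thesis by simp
  qed
  moreover have "4 * k * card V + (\<Sum>i\<in>I. h i) \<le> card U + 4 * k * (\<Sum>i\<in>I. card (X i))"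
  proof -
    have mA: "card {i \<in> I. v \<in> A i} = of_bool (m v = 1)" for v
      by (cases "m v = 1") (auto simp: A_def m_def)
    have mX: "card {i \<in> I. v \<in> X i - A i} = (if m v = 1 then 0 else m v)" for v
      by (cases "m v = 1") (auto simp: A_def m_def)
    have "(\<Sum>i\<in>I. card (X i - A i)) = (\<Sum>v\<in>V. if m v = 1 then 0 else m v)"
      using sum_double_count[OF I(1) finV, of "\<lambda>i. X i - A i" "\<lambda>_. 1"] XV unfolding mX by auto
    moreover have "(\<Sum>i\<in>I. \<Sum>v\<in>A i. dU v) = (\<Sum>v\<in>V. of_bool (m v = 1) * dU v)"
      using sum_double_count[OF I(1) finV, of A dU] XV unfolding mA by (force simp: A_def)
    moreover have "(\<Sum>i\<in>I. h i) \<le> 2 * k * (\<Sum>i\<in>I. card (X i - A i)) + (\<Sum>i\<in>I. \<Sum>v\<in>A i. dU v)"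
      unfolding h_def sum.distrib sum_distrib_left using arcsA by (intro add_mono sum_mono) auto
    ultimately have "4 * k * card V + (\<Sum>i\<in>I. h i)
      \<le> (\<Sum>v\<in>V. 4 * k + 2 * k * (if m v = 1 then 0 else m v) + of_bool (m v = 1) * dU v)"
      by (simp add: sum.distrib sum_distrib_left)
    also have "\<dots> \<le> (\<Sum>v\<in>V. dU v + 4 * k * m v)"
    proof (rule sum_mono)
      fix v assume v: "v \<in> V"
      consider "m v = 0" | "m v = 1" | "m v \<ge> 2" by linarith
      then show "4 * k + 2 * k * (if m v = 1 then 0 else m v) + of_bool (m v = 1) * dU v \<le> dU v + 4 * k * m v"
      proof cases
        case 1
        then have "v \<notin> X i" if "i \<in> I" for i using that I(1) by (auto simp: m_def)
        then have "{u. (v, u) \<in> U} = {u. (v, u) \<in> parcs G}" by (auto simp: U_def)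
        then show ?thesis using 1 deg[of v] v by (simp add: dU_def degree_of_eq_card V_def)
      next
        case 3
        then have "2 * k * 2 \<le> 2 * k * m v" by (intro mult_le_mono) auto
        moreover have "4 * k * m v = 2 * k * m v + 2 * k * m v" by simp
        ultimately have le: "4 * k + 2 * k * m v \<le> 4 * k * m v" by linarith
        have m: "(if m v = 1 then 0 else m v) = m v" "of_bool (m v = 1) * dU v = 0"
          using 3 by auto
        show ?thesis unfolding m using le by linarith
      qed simp
    qed
    also have "\<dots> = card U + 4 * k * (\<Sum>i\<in>I. card (X i))"
      using sum_double_count[OF I(1) finV, of X "\<lambda>_. 1"] XV
      by (simp add: sum.distrib cardU m_def flip: sum_distrib_left)
    finally show ?thesis .
  qed
  ultimately show ?thesis unfolding V_def[symmetric] U_def[symmetric] by linarith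
qed

definition edges_of :: "'a pair_pre_digraph \<Rightarrow> 'a set set" where
  "edges_of G = (\<lambda>(u, v). {u, v}) ` parcs G"

lemma edges_ofE:
  assumes "pair_graph G" "e \<in> edges_of G"
  shows "e \<subseteq> pverts G" "card e = 2"
proof -
  interpret pair_graph G by fact
  obtain u v where uv: "(u, v) \<in> parcs G" "e = {u, v}" using assms(2) by (auto simp: edges_of_def)
  then have "u \<in> pverts G" "v \<in> pverts G" "u \<noteq> v"
    using in_arcsD1 in_arcsD2 no_loops' by auto
  then show "e \<subseteq> pverts G" "card e = 2" using uv by auto
qed

lemma edges_of_iff:
  assumes "pair_graph G"
  shows "{u, v} \<in> edges_of G \<longleftrightarrow> (u, v) \<in> parcs G"
proof -
  interpret pair_graph G by fact
  show ?thesis by (auto simp: edges_of_def doubleton_eq_iff intro: arcs_symmetric)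
qed

lemma card_arcs_le_twice_edges:
  assumes "finite D" "\<And>u v. (u, v) \<in> U \<Longrightarrow> {u, v} \<in> D" "\<And>e. e \<in> D \<Longrightarrow> card e = 2"
  shows "card U \<le> 2 * card D"
proof -
  have two: "card {(u, v). {u, v} = e} \<le> 2 \<and> finite {(u, v). {u, v} = e}" if e: "e \<in> D" for e
  proof -
    obtain x y where xy: "e = {x, y}" using assms(3)[OF e] by (meson card_2_iff)
    have sub: "{(u, v). {u, v} = e} \<subseteq> {(x, y), (y, x)}"
    proof
      fix z assume "z \<in> {(u, v). {u, v} = e}"
      then obtain u v where z: "z = (u, v)" "{u, v} = {x, y}" unfolding xy by auto
      from z(2) have "u = x \<and> v = y \<or> u = y \<and> v = x" unfolding doubleton_eq_iff .
      then show "z \<in> {(x, y), (y, x)}" unfolding z(1) by (elim disjE) simp_all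
    qed
    have "card {c, d} \<le> 2" for c d :: "'a \<times> 'a" by (cases "c = d") auto
    then have "card {(x, y), (y, x)} \<le> 2" .
    moreover have fin: "finite {(x, y), (y, x)}" by (intro finite.intros)
    ultimately show ?thesis using card_mono[OF fin sub] finite_subset[OF sub fin] le_trans by blast
  qed
  have "U \<subseteq> (\<Union>e\<in>D. {(u, v). {u, v} = e})" using assms(2) by auto
  then have "card U \<le> card (\<Union>e\<in>D. {(u, v). {u, v} = e})"
    using assms(1) two by (intro card_mono) auto
  also have "\<dots> \<le> (\<Sum>e\<in>D. card {(u, v). {u, v} = e})" by (rule card_UN_le[OF assms(1)])
  also have "\<dots> \<le> (\<Sum>e\<in>D. 2)" using two by (intro sum_mono) auto
  finally show ?thesis by simp
qed

text \<open>
  Parts that span only two vertices are single edges, whose rank one is paid for by counting the edge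
  as uncovered. This restricts the discharging argument to parts that span at least three vertices.
\<close>

lemma edge_of_small_part:
  assumes "B \<noteq> {}" "finite (\<Union>B)" "card (\<Union>B) < 3" "\<And>e. e \<in> B \<Longrightarrow> card e = 2"
  shows "card B = 1" "laman_bound B = 1"
proof -
  have c: "card (\<Union>B) = 2" using card_Union_edges_ge[OF assms(1,2,4)] assms(3) by simp
  have "e = \<Union>B" if "e \<in> B" for e
    using that c assms(2,4) by (intro card_subset_eq) auto
  then have "B = {\<Union>B}" using assms(1) by blast
  then show "card B = 1" by (metis card.empty card_1_singleton_iff One_nat_def)
  show "laman_bound B = 1" using c by (simp add: laman_bound_def)
qed

text \<open>
  Discharging is applied to the vertex sets spanned by the parts of an optimal partition of \<open>F\<close>,
  indexed by the parts since different parts may span the same set. Each uncovered edge accounts for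
  two uncovered arcs, so all terms are doubled: \<open>2 (2 |X| - 3) = 4 |X| - 6\<close>.
\<close>

lemma rank_condition:
  fixes G :: "'a pair_pre_digraph"
  assumes G: "pair_graph G" and k: "k \<ge> 1" and deg: "\<And>v. v \<in> pverts G \<Longrightarrow> degree_of G v \<ge> 4 * k"
    and weak: "\<And>X A Y B. weakly_attached G k X A \<Longrightarrow> weakly_attached G k Y B \<Longrightarrow>
      A \<inter> Y = {} \<Longrightarrow> B \<inter> X = {} \<Longrightarrow> False"
    and F: "F \<subseteq> edges_of G"
  shows "k * (2 * card (pverts G) - 3) \<le> card (edges_of G - F) + k * rigidity_rank F"
proof -
  interpret pair_graph G by fact
  define E where "E = edges_of G"
  have E: "e \<subseteq> pverts G" "card e = 2" if "e \<in> E" for e using edges_ofE[OF G] that by (auto simp: E_def)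
  have finE: "finite E" by (simp add: E_def edges_of_def)
  have finF: "finite F" using F finE finite_subset by (auto simp: E_def)
  obtain P where P: "partition_on F P" "sum laman_bound P = rigidity_rank F"
    by (rule dilworth_truncation_attained)
  have finP: "finite P" using finite_elements[OF finF P(1)] .
  have PE: "B \<subseteq> E" "B \<noteq> {}" if "B \<in> P" for B
    using that partition_onD1[OF P(1)] partition_onD3[OF P(1)] F by (auto simp: E_def)
  have PV: "\<Union>B \<subseteq> pverts G" if "B \<in> P" for B
    by (rule Union_least) (use PE(1)[OF that] E(1) in blast)
  have finUB: "finite (\<Union>B)" if "B \<in> P" for B using finite_subset[OF PV[OF that]] by simp
  define I where "I = {B \<in> P. card (\<Union>B) \<ge> 3}"
  have I: "I \<subseteq> P" "finite I" using finP by (auto simp: I_def)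
  have small: "card B = 1" "laman_bound B = 1" if "B \<in> P - I" for B
  proof -
    have B: "B \<in> P" "card (\<Union>B) < 3" using that by (auto simp: I_def)
    have "card e = 2" if "e \<in> B" for e using PE(1)[OF B(1)] that E(2) by blast
    then show "card B = 1" "laman_bound B = 1"
      using edge_of_small_part[OF PE(2)[OF B(1)] finUB[OF B(1)] B(2)] by blast+
  qed
  have rank: "rigidity_rank F = (\<Sum>B\<in>I. laman_bound B) + card (P - I)"
  proof -
    have "sum laman_bound P = sum laman_bound (P - I) + sum laman_bound I"
      using I finP by (intro sum.subset_diff) auto
    then show ?thesis using P(2) small(2) by simp
  qed
  define D where "D = E - \<Union>I"
  have "D \<subseteq> (E - F) \<union> \<Union>(P - I)" using partition_onD1[OF P(1)] by (auto simp: D_def)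
  then have "card D \<le> card ((E - F) \<union> \<Union>(P - I))"
    using finE finP PE by (intro card_mono) (auto intro: finite_subset)
  also have "\<dots> \<le> card (E - F) + card (\<Union>(P - I))" by (rule card_Un_le)
  also have "card (\<Union>(P - I)) \<le> (\<Sum>B\<in>P - I. card B)"
    using card_UN_le[of "P - I" "\<lambda>B. B"] finP by simp
  also have "\<dots> = card (P - I)" using small(1) by simp
  finally have D: "card D \<le> card (E - F) + card (P - I)" by simp
  define U where "U = {(u, v) \<in> parcs G. \<forall>B\<in>I. \<not> (u \<in> \<Union>B \<and> v \<in> \<Union>B)}"
  have "card U \<le> 2 * card D"
  proof (rule card_arcs_le_twice_edges)
    show "finite D" using finE by (simp add: D_def)
    show "card e = 2" if "e \<in> D" for e using E that by (simp add: D_def)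
    show "{u, v} \<in> D" if uv: "(u, v) \<in> U" for u v
    proof -
      have "{u, v} \<in> E" using uv edges_of_iff[OF G] by (auto simp: U_def E_def)
      moreover have "{u, v} \<notin> B" if "B \<in> I" for B using uv that by (auto simp: U_def)
      ultimately show ?thesis by (auto simp: D_def)
    qed
  qed
  moreover have "4 * k * card (pverts G) + 6 * k * card I
      \<le> card U + 4 * k * (\<Sum>B\<in>I. card (\<Union>B)) + 6 * k"
    unfolding U_def
  proof (rule discharging[OF G deg I(2)])
    show "\<Union>B \<subseteq> pverts G" "3 \<le> card (\<Union>B)" if "B \<in> I" for B using that PV by (auto simp: I_def)
  qed (use weak in blast)+
  moreover have "2 * (\<Sum>B\<in>I. laman_bound B) + 6 * card I = 4 * (\<Sum>B\<in>I. card (\<Union>B))"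
  proof -
    have "2 * laman_bound B + 6 = 4 * card (\<Union>B)" if "B \<in> I" for B
    proof -
      have "card (\<Union>B) \<ge> 3" using that by (simp add: I_def)
      then show ?thesis unfolding laman_bound_def by linarith
    qed
    then have "(\<Sum>B\<in>I. 2 * laman_bound B + 6) = (\<Sum>B\<in>I. 4 * card (\<Union>B))" by simp
    then show ?thesis by (simp add: sum.distrib sum_distrib_left)
  qed
  then have "k * (2 * (\<Sum>B\<in>I. laman_bound B) + 6 * card I) = k * (4 * (\<Sum>B\<in>I. card (\<Union>B)))" by simp
  ultimately have D': "4 * k * card (pverts G) \<le> 2 * card D + 2 * (k * (\<Sum>B\<in>I. laman_bound B)) + 6 * k"
    by (simp add: algebra_simps)
  have kP: "card (P - I) \<le> k * card (P - I)" using k by simp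
  have "k * rigidity_rank F = k * (\<Sum>B\<in>I. laman_bound B) + k * card (P - I)"
    by (simp add: rank distrib_left)
  then have "4 * k * card (pverts G) \<le> 2 * card (E - F) + 2 * (k * rigidity_rank F) + 6 * k"
    using D' kP D by linarith
  then show ?thesis by (simp add: E_def algebra_simps diff_mult_distrib2)
qed

text \<open>
  A purely combinatorial criterion: the rank condition with \<open>F = E\<close> shows that the whole edge set has
  the full rank \<open>2 n - 3\<close>, so the packing theorem provides \<open>k\<close> disjoint edge sets of this rank.
\<close>

theorem edge_disjoint_two_connected_of_weakly_attached:
  fixes G :: "'a pair_pre_digraph"
  assumes G: "pair_graph G" and k: "k \<ge> 1" and n: "card (pverts G) \<ge> 3"
    and deg: "\<And>v. v \<in> pverts G \<Longrightarrow> degree_of G v \<ge> 4 * k"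
    and weak: "\<And>X A Y B. weakly_attached G k X A \<Longrightarrow> weakly_attached G k Y B \<Longrightarrow>
      A \<inter> Y = {} \<Longrightarrow> B \<inter> X = {} \<Longrightarrow> False"
  shows "\<exists>H. edge_disjoint_spanning_two_connected G k H"
proof -
  interpret pair_graph G by fact
  define V E where "V = pverts G" and "E = edges_of G"
  have E: "e \<subseteq> V" "card e = 2" if "e \<in> E" for e using edges_ofE[OF G] that by (auto simp: E_def V_def)
  have finE: "finite E" by (simp add: E_def edges_of_def)
  have UE: "\<Union>E \<subseteq> V" using E by blast
  have finUE: "finite (\<Union>E)" using finite_subset[OF UE] by (simp add: V_def)
  have cond: "k * (2 * card V - 3) \<le> card (E - F) + k * rigidity_rank F" if "F \<subseteq> E" for F
    unfolding E_def V_def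
    by (rule rank_condition[OF G k deg _ that[unfolded E_def]]) (assumption | use weak in blast)+
  have "rigidity_rank E \<le> 2 * card V - 3"
    using dilworth_truncation_le_self[of laman_bound E] laman_bound_le[OF UE] by (simp add: V_def)
  moreover have "k * (2 * card V - 3) \<le> k * rigidity_rank E" using cond[of E] by simp
  then have "2 * card V - 3 \<le> rigidity_rank E" using k by simp
  ultimately have rankE: "rigidity_rank E = 2 * card V - 3" by simp
  have "\<exists>S. (\<forall>i<k. S i \<subseteq> E \<and> rigidity_rank (S i) = rigidity_rank E) \<and>
      (\<forall>i j. i \<noteq> j \<longrightarrow> S i \<inter> S j = {})"
  proof (rule disjoint_full_rank_subsets[OF finE])
    show "rigidity_rank F \<le> rigidity_rank F'" if "F \<subseteq> F'" "F' \<subseteq> E" for F F'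
    proof (rule dilworth_truncation_mono[OF _ that(1)])
      show "finite F'" using that(2) finE finite_subset by blast
      show "laman_bound A \<le> laman_bound B" if "A \<subseteq> B" "B \<subseteq> F'" for A B
        using that \<open>F' \<subseteq> E\<close> finUE by (intro laman_bound_mono) (meson Union_mono finite_subset)+
    qed
    show "rigidity_rank (F \<union> F') + rigidity_rank (F \<inter> F') \<le> rigidity_rank F + rigidity_rank F'"
      if "F \<subseteq> E" "F' \<subseteq> E" for F F'
      using intersecting_submodular_laman_bound[OF finUE E(2)] finE that
      by (rule dilworth_truncation_submodular)
    show "k * rigidity_rank E \<le> card (E - F) + k * rigidity_rank F" if "F \<subseteq> E" for F
      using cond[OF that] rankE by simp
  qed
  then obtain S where S: "\<And>i. i < k \<Longrightarrow> S i \<subseteq> E" "\<And>i. i < k \<Longrightarrow> rigidity_rank (S i) = rigidity_rank E"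
    "\<And>i j. i \<noteq> j \<Longrightarrow> S i \<inter> S j = {}"
    by blast
  define H where "H i = edge_graph V (S i)" for i
  have pg: "pair_graph (H i)" if "i < k" for i
    unfolding H_def using S(1)[OF that] E by (intro pair_graph_edge_graph) (auto simp: V_def)
  have sub: "parcs (H i) \<subseteq> parcs G" if "i < k" for i
    using S(1)[OF that] edges_of_iff[OF G] by (auto simp: H_def E_def)
  have "spanning (with_proj (H i)) (with_proj G)" if "i < k" for i
    unfolding spanning_def subgraph_def
  proof (intro conjI)
    interpret Hi: pair_graph "H i" using pg[OF that] .
    show "wf_digraph (with_proj (H i))" by unfold_locales
    show "wf_digraph (with_proj G)" by unfold_locales
  qed (use sub[OF that] in \<open>auto simp: H_def V_def\<close>)
  moreover have "two_connected (H i)" if "i < k" for i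
    unfolding H_def using S(1,2)[OF that] E n rankE
    by (intro two_connected_of_full_rank) (auto simp: V_def)
  moreover have "parcs (H i) \<inter> parcs (H j) = {}" if "i \<noteq> j" for i j
    using S(3)[OF that] by (auto simp: H_def)
  ultimately have "edge_disjoint_spanning_two_connected G k H"
    unfolding edge_disjoint_spanning_two_connected_def using pg by blast
  then show ?thesis by blast
qed

section \<open>Weakly attached sets in biregular graphs\<close>

lemma arcs_between_commute:
  assumes "pair_graph G"
  shows "arcs_between G A B = arcs_between G B A"
proof -
  interpret pair_graph G by fact
  have "prod.swap ` (parcs G \<inter> A \<times> B) = parcs G \<inter> B \<times> A"
    by (force intro: arcs_symmetric)
  then show ?thesis unfolding arcs_between_def by (metis card_image inj_on_subset inj_swap subset_UNIV)
qed

lemma arcs_between_mono: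
  assumes "pair_graph G" "A \<subseteq> A'" "B \<subseteq> B'"
  shows "arcs_between G A B \<le> arcs_between G A' B'"
proof -
  interpret pair_graph G by fact
  show ?thesis unfolding arcs_between_def using assms(2,3) by (intro card_mono) auto
qed

lemma arcs_between_Un_le: "arcs_between G A (B \<union> C) \<le> arcs_between G A B + arcs_between G A C"
proof -
  have "parcs G \<inter> A \<times> (B \<union> C) = (parcs G \<inter> A \<times> B) \<union> (parcs G \<inter> A \<times> C)" by auto
  then show ?thesis unfolding arcs_between_def by (metis card_Un_le)
qed

lemma arcs_between_eq_sum:
  assumes "pair_graph G" "finite A"
  shows "arcs_between G A B = (\<Sum>v\<in>A. card {u \<in> B. (v, u) \<in> parcs G})"
proof -
  interpret pair_graph G by fact
  have "parcs G \<inter> A \<times> B = (parcs G \<inter> UNIV \<times> B) \<inter> A \<times> UNIV" by auto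
  then show ?thesis using card_arcs_by_tail[of "parcs G \<inter> UNIV \<times> B" A] assms(2)
    by (simp add: arcs_between_def conj_commute)
qed

lemma arcs_between_le_degree:
  assumes "pair_graph G" "finite A" "\<And>v. v \<in> A \<Longrightarrow> degree_of G v \<le> M"
  shows "arcs_between G A B \<le> card A * M"
proof -
  interpret pair_graph G by fact
  have "card {u \<in> B. (v, u) \<in> parcs G} \<le> M" if "v \<in> A" for v
  proof -
    have "finite {u. (v, u) \<in> parcs G}"
      by (rule finite_subset[of _ "pverts G"]) (use in_arcsD2 in auto)
    then have "card {u \<in> B. (v, u) \<in> parcs G} \<le> degree_of G v"
      unfolding degree_of_eq_card by (intro card_mono) auto
    then show ?thesis using assms(3)[OF that] by simp
  qed
  then show ?thesis unfolding arcs_between_eq_sum[OF assms(1,2)]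
    using sum_bounded_above[of A _ M] by simp
qed

text \<open>
  In the application, \<open>A\<close> has \<open>p\<close> vertices of degree \<open>a\<close> and \<open>q\<close> of degree \<open>b\<close>, and \<open>X - A\<close> has \<open>x\<close>
  and \<open>y\<close> of them. A vertex of degree \<open>a\<close> has at most \<open>q + y\<close> neighbours in \<open>X\<close>, hence at least
  \<open>a - (q + y)\<close> outside. If \<open>q\<close> were below \<open>a div 2\<close>, two such vertices would already have too many
  neighbours outside, and so would a single one together with the \<open>q\<close> vertices of degree \<open>b\<close>, or
  a vertex of degree \<open>b\<close> if there is none of degree \<open>a\<close>.
\<close>

lemma few_missing_arcs:
  fixes a b k p q x y :: nat
  assumes k: "k \<ge> 1" and ab: "a \<ge> 6 * k" "b \<ge> 6 * k" and ne: "p + q \<ge> 1"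
    and less: "2 * k * (x + y) + p * (a - (q + y)) + q * (b - (p + x)) < 6 * k"
  shows "a div 2 \<le> q"
proof (rule ccontr)
  assume "\<not> a div 2 \<le> q"
  then have q: "2 * q + 2 \<le> a" by linarith
  have z: "x + y \<le> 2 * k * (x + y)" using k by simp
  have "2 * k * (x + y) < 2 * k * 3" using less by linarith
  then have xy: "x + y < 3" unfolding nat_mult_less_cancel_disj by blast
  consider "p = 0" | "p = 1" | "p \<ge> 2" by linarith
  then show False
  proof cases
    case 1
    then have "1 * (b - x) \<le> q * (b - (p + x))" using ne by (intro mult_le_mono) auto
    then show False using less z ab by linarith
  next
    case 2
    have "q * 1 \<le> q * (b - (p + x))" using 2 xy ab k by (intro mult_le_mono) auto
    moreover have "p * (a - (q + y)) = a - (q + y)" using 2 by simp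
    moreover have "a \<le> (a - (q + y)) + q + y" by linarith
    ultimately show False using less z ab by linarith
  next
    case 3
    then have "2 * (a - (q + y)) \<le> p * (a - (q + y))" by (intro mult_le_mono) auto
    moreover have "2 * y \<le> 2 * k * (x + y)" using k by (metis add_leD2 le_refl mult.assoc mult_le_mono mult_le_mono2 nat_mult_1 le_add2 mult_numeral_1_right order_trans)
    ultimately show False using less ab q by linarith
  qed
qed

lemma weakly_attached_card_ge:
  fixes G :: "'a pair_pre_digraph" and a b k :: nat
  assumes G: "pair_graph G" and k: "k \<ge> 1" and ab: "a \<ge> 6 * k" "b \<ge> 6 * k"
    and bip: "bipartition G X Y"
    and degX: "\<And>x. x \<in> X \<Longrightarrow> degree_of G x = a" and degY: "\<And>y. y \<in> Y \<Longrightarrow> degree_of G y = b"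
    and weak: "weakly_attached G k W A"
  shows "a div 2 \<le> card (A \<inter> Y)" "b div 2 \<le> card (A \<inter> X)"
proof -
  interpret pair_graph G by fact
  have V: "X \<inter> Y = {}" "X \<union> Y = pverts G" "parcs G \<subseteq> X \<times> Y \<union> Y \<times> X"
    using bip by (auto simp: bipartition_def)
  have A: "A \<noteq> {}" "A \<subseteq> W" "W \<subseteq> pverts G"
    and less: "2 * k * card (W - A) + arcs_between G A (pverts G - W) < 6 * k"
    using weak by (auto simp: weakly_attached_def)
  have finW: "finite W" using finite_subset[OF A(3)] by simp
  have finA: "finite A" using finite_subset[OF A(2) finW] .
  have out: "d - card (W \<inter> Z) \<le> card {u \<in> pverts G - W. (v, u) \<in> parcs G}"
    if "degree_of G v = d" "\<And>u. (v, u) \<in> parcs G \<Longrightarrow> u \<in> Z" for v d Z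
  proof -
    have "{u. (v, u) \<in> parcs G} \<subseteq> {u \<in> pverts G - W. (v, u) \<in> parcs G} \<union> (W \<inter> Z)"
      using that(2) in_arcsD2 by auto
    then have "card {u. (v, u) \<in> parcs G} \<le> card ({u \<in> pverts G - W. (v, u) \<in> parcs G} \<union> (W \<inter> Z))"
      using finW by (intro card_mono) auto
    also have "\<dots> \<le> card {u \<in> pverts G - W. (v, u) \<in> parcs G} + card (W \<inter> Z)" by (rule card_Un_le)
    finally show ?thesis using that(1) by (simp add: degree_of_eq_card)
  qed
  define p q x y where "p = card (A \<inter> X)" and "q = card (A \<inter> Y)"
    and "x = card ((W - A) \<inter> X)" and "y = card ((W - A) \<inter> Y)"
  have WX: "card (W \<inter> X) = p + x" and WY: "card (W \<inter> Y) = q + y"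
  proof -
    have "W \<inter> Z = (A \<inter> Z) \<union> ((W - A) \<inter> Z)" "(A \<inter> Z) \<inter> ((W - A) \<inter> Z) = {}" for Z using A(2) by auto
    then have "card (W \<inter> Z) = card (A \<inter> Z) + card ((W - A) \<inter> Z)" for Z
      using finW finA by (metis card_Un_disjoint finite_Diff finite_Int)
    then show "card (W \<inter> X) = p + x" "card (W \<inter> Y) = q + y" by (simp_all add: p_def q_def x_def y_def)
  qed
  have split: "card S = card (S \<inter> X) + card (S \<inter> Y)" if "S \<subseteq> pverts G" for S
  proof -
    have "S = (S \<inter> X) \<union> (S \<inter> Y)" using that V(2) by auto
    moreover have "finite S" using finite_subset[OF that] by simp
    moreover have "(S \<inter> X) \<inter> (S \<inter> Y) = {}" using V(1) by auto
    ultimately show ?thesis by (metis card_Un_disjoint finite_Int)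
  qed
  have WA: "card (W - A) = x + y" using split[of "W - A"] A by (auto simp: x_def y_def)
  have "card A = p + q" using split[of A] A by (auto simp: p_def q_def)
  then have ne: "p + q \<ge> 1" using A(1) finA by (metis Suc_leI card_gt_0_iff One_nat_def)
  have "p * (a - (q + y)) + q * (b - (p + x)) \<le> arcs_between G A (pverts G - W)"
  proof -
    have "(\<Sum>v\<in>A \<inter> X. a - (q + y)) \<le> (\<Sum>v\<in>A \<inter> X. card {u \<in> pverts G - W. (v, u) \<in> parcs G})"
    proof (rule sum_mono)
      fix v assume v: "v \<in> A \<inter> X"
      have "u \<in> Y" if "(v, u) \<in> parcs G" for u using that v V(1,3) by auto
      then show "a - (q + y) \<le> card {u \<in> pverts G - W. (v, u) \<in> parcs G}"
        using out[of v a Y] degX v WY by auto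
    qed
    moreover have "(\<Sum>v\<in>A \<inter> Y. b - (p + x)) \<le> (\<Sum>v\<in>A \<inter> Y. card {u \<in> pverts G - W. (v, u) \<in> parcs G})"
    proof (rule sum_mono)
      fix v assume v: "v \<in> A \<inter> Y"
      have "u \<in> X" if "(v, u) \<in> parcs G" for u using that v V(1,3) by auto
      then show "b - (p + x) \<le> card {u \<in> pverts G - W. (v, u) \<in> parcs G}"
        using out[of v b X] degY v WX by auto
    qed
    moreover have "A = (A \<inter> X) \<union> (A \<inter> Y)" and disj: "(A \<inter> X) \<inter> (A \<inter> Y) = {}" using A V by auto
    from sum.cong[OF this(1) refl] have "(\<Sum>v\<in>A. card {u \<in> pverts G - W. (v, u) \<in> parcs G})
      = (\<Sum>v\<in>A \<inter> X. card {u \<in> pverts G - W. (v, u) \<in> parcs G})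
        + (\<Sum>v\<in>A \<inter> Y. card {u \<in> pverts G - W. (v, u) \<in> parcs G})"
      by (rule trans) (rule sum.union_disjoint; use finA disj in auto)
    moreover have "(\<Sum>v\<in>A \<inter> X. a - (q + y)) = p * (a - (q + y))"
      "(\<Sum>v\<in>A \<inter> Y. b - (p + x)) = q * (b - (p + x))"
      by (simp_all add: p_def q_def)
    ultimately show ?thesis unfolding arcs_between_eq_sum[OF G finA] by linarith
  qed
  then have bound: "2 * k * (x + y) + p * (a - (q + y)) + q * (b - (p + x)) < 6 * k"
    using less unfolding WA by linarith
  then show "a div 2 \<le> card (A \<inter> Y)"
    using few_missing_arcs[OF k ab ne] by (simp add: q_def)
  have "q + p \<ge> 1" "2 * k * (y + x) + q * (b - (p + x)) + p * (a - (q + y)) < 6 * k"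
    using ne bound by (simp_all add: add_ac)
  then show "b div 2 \<le> card (A \<inter> X)"
    using few_missing_arcs[OF k ab(2,1)] by (simp add: p_def)
qed

text \<open>
  With \<open>z = card (W - A)\<close> and \<open>c\<close> the number of arcs from \<open>A\<close> to the complement of \<open>W\<close>, the sum is at
  most \<open>2 c + z M\<close>, where \<open>2 k z + c < 6 k\<close>. So it is less than \<open>12 k\<close>, \<open>8 k + M\<close> or \<open>4 k + 2 M\<close> for
  \<open>z = 0, 1, 2\<close>; this is where \<open>M \<ge> 6 k\<close> enters.
\<close>

lemma weakly_attached_boundary:
  assumes G: "pair_graph G" and deg: "\<And>v. v \<in> pverts G \<Longrightarrow> degree_of G v \<le> M" and M: "M \<ge> 6 * k"
    and weak: "weakly_attached G k W A" and B: "B \<subseteq> pverts G - W"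
  shows "arcs_between G A (pverts G - A) + arcs_between G A B < 6 * k + 2 * M"
proof -
  interpret pair_graph G by fact
  define c z where "c = arcs_between G A (pverts G - W)" and "z = card (W - A)"
  have A: "A \<subseteq> W" "W \<subseteq> pverts G" and less: "2 * k * z + c < 6 * k"
    using weak by (auto simp: weakly_attached_def c_def z_def)
  have "pverts G - A = (pverts G - W) \<union> (W - A)" using A by auto
  then have "arcs_between G A (pverts G - A) \<le> c + arcs_between G A (W - A)"
    using arcs_between_Un_le[of G A "pverts G - W" "W - A"] by (simp add: c_def)
  moreover have "arcs_between G A (W - A) \<le> z * M"
  proof -
    have "finite (W - A)" using finite_subset[OF A(2)] by simp
    moreover have "degree_of G v \<le> M" if "v \<in> W - A" for v using deg A(2) that by blast
    ultimately show ?thesis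
      unfolding arcs_between_commute[OF G, of A] z_def by (rule arcs_between_le_degree[OF G])
  qed
  moreover have "arcs_between G A B \<le> c"
    unfolding c_def using arcs_between_mono[OF G order_refl B] .
  moreover have "2 * c + z * M < 6 * k + 2 * M"
  proof -
    have "2 * k * z < 2 * k * 3" using less by linarith
    then have "z < 3" unfolding nat_mult_less_cancel_disj by blast
    then consider "z = 0" | "z = 1" | "z = 2" by linarith
    then show ?thesis using less M by cases auto
  qed
  ultimately show ?thesis by linarith
qed

lemma ceiling_half_pred: "\<lceil>(real a - 1) / 2\<rceil> = int (a div 2)"
proof (rule ceiling_unique)
  have "real a = 2 * real (a div 2) + real (a mod 2)"
    by (metis (no_types, opaque_lifting) div_mult_mod_eq mult.commute of_nat_add of_nat_mult of_nat_numeral)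
  moreover have "a mod 2 \<le> 1" by simp
  then have "real (a mod 2) \<le> 1" by linarith
  ultimately show "real_of_int (int (a div 2)) - 1 < (real a - 1) / 2"
    "(real a - 1) / 2 \<le> real_of_int (int (a div 2))"
    by auto
qed

text \<open>
  A lower bound for the volume \<open>a p + b q\<close> of a set with \<open>p\<close> vertices of degree \<open>a\<close> and \<open>q\<close> of
  degree \<open>b\<close>, by the inequality between the arithmetic and the geometric mean.
\<close>

lemma weighted_sum_ge_geometric_mean:
  fixes a b p q m n :: nat
  assumes "m \<le> p" "n \<le> q"
  shows "2 * (sqrt (real a * real b) * sqrt (real m * real n)) \<le> real (a * p + b * q)"
proof -
  have "sqrt (real m * real n) \<le> sqrt (real p * real q)"
    using assms by (intro real_sqrt_le_mono mult_mono) auto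
  then have "sqrt (real a * real b) * sqrt (real m * real n) \<le> sqrt (real a * real b) * sqrt (real p * real q)"
    by (rule mult_left_mono) simp
  also have "\<dots> = sqrt ((real a * real p) * (real b * real q))"
    by (simp add: real_sqrt_mult mult_ac)
  also have "\<dots> \<le> (real a * real p + real b * real q) / 2" by (rule arith_geo_mean_sqrt) auto
  finally show ?thesis by simp
qed

theorem corollary2p5:
  fixes G :: "'a pair_pre_digraph" and a b k :: nat
  assumes "k \<ge> 1"
    and "pair_graph G"
    and "biregular_bipartite a b G"
    and "a \<ge> 6 * k" and "b \<ge> 6 * k"
    and "nth_eigenvalue G 2 \<le> sqrt (real a * real b)
           - (3 * real k + real (max a b))
             / sqrt (real_of_int (\<lceil>(real a - 1) / 2\<rceil> * \<lceil>(real b - 1) / 2\<rceil>))"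
  shows "\<exists>H :: nat \<Rightarrow> 'a pair_pre_digraph. edge_disjoint_spanning_two_connected G k H"
proof -
  note k = assms(1) and G = assms(2) and ab = assms(4,5)
  interpret pair_graph G by fact
  obtain X Y where bip: "bipartition G X Y"
    and degX: "\<And>x. x \<in> X \<Longrightarrow> degree_of G x = a" and degY: "\<And>y. y \<in> Y \<Longrightarrow> degree_of G y = b"
    using assms(3) unfolding biregular_bipartite_def by blast
  have V: "X \<noteq> {}" "Y \<noteq> {}" "X \<inter> Y = {}" "X \<union> Y = pverts G" "parcs G \<subseteq> X \<times> Y \<union> Y \<times> X"
    using bip by (auto simp: bipartition_def)
  define M where "M = max a b"
  have deg: "degree_of G v = a \<or> degree_of G v = b" if "v \<in> pverts G" for v
    using that V(4) degX degY by blast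
  have ab0: "a > 0" "b > 0" using ab k by auto
  have prod: "degree_of G u * degree_of G v = a * b" if "(u, v) \<in> parcs G" for u v
    using that V(5) degX degY by auto
  define \<gamma> where "\<gamma> = sqrt (real (a * b)) - nth_eigenvalue G 2"
  define s where "s = sqrt (real (a div 2) * real (b div 2))"
  have s: "s > 0" using ab k by (auto simp: s_def)
  \<comment> \<open>The assumption on the second eigenvalue, cleared of its denominator.\<close>
  have gap: "3 * real k + real M \<le> \<gamma> * s"
    using assms(6) s unfolding ceiling_half_pred
    by (simp add: \<gamma>_def M_def field_simps flip: s_def)
  have vol: "sqrt (real (a * b)) * (6 * real k + 2 * real M) \<le> \<gamma> * real (volume G A)"
    if weak: "weakly_attached G k W A" for W A
  proof -
    have "A \<subseteq> pverts G" using weak by (auto simp: weakly_attached_def)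
    then have finA: "finite A" and A: "A = (A \<inter> X) \<union> (A \<inter> Y)" "(A \<inter> X) \<inter> (A \<inter> Y) = {}"
      using V finite_subset[of A "pverts G"] by auto
    have "volume G A = (\<Sum>v\<in>A \<inter> X. degree_of G v) + (\<Sum>v\<in>A \<inter> Y. degree_of G v)"
      unfolding volume_def using A finA by (metis finite_Int sum.union_disjoint)
    then have volA: "volume G A = a * card (A \<inter> X) + b * card (A \<inter> Y)"
      using degX degY by simp
    have "2 * (sqrt (real a * real b) * sqrt (real (b div 2) * real (a div 2))) \<le> real (volume G A)"
      unfolding volA using weakly_attached_card_ge[OF G k ab bip degX degY weak]
      by (intro weighted_sum_ge_geometric_mean) auto
    then have "2 * (sqrt (real (a * b)) * s) \<le> real (volume G A)" by (simp add: s_def mult.commute)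
    moreover have "\<gamma> > 0"
    proof (rule ccontr)
      assume "\<not> \<gamma> > 0"
      then have "\<gamma> * s \<le> 0" using s by (simp add: mult_nonpos_nonneg)
      then show False using gap k by simp
    qed
    ultimately have "\<gamma> * (2 * (sqrt (real (a * b)) * s)) \<le> \<gamma> * real (volume G A)"
      by (intro mult_left_mono) auto
    moreover have "sqrt (real (a * b)) * (2 * (3 * real k + real M)) \<le> sqrt (real (a * b)) * (2 * (\<gamma> * s))"
      using gap by (intro mult_left_mono) auto
    ultimately show ?thesis by (simp add: algebra_simps)
  qed
  have small: "sqrt (real (a * b)) * (arcs_between G A (pverts G - A) + arcs_between G A B) < \<gamma> * real (volume G A)"
    if weak: "weakly_attached G k W A" and B: "B \<subseteq> pverts G - W" for W A B
  proof -
    have "arcs_between G A (pverts G - A) + arcs_between G A B < 6 * k + 2 * M"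
    proof (rule weakly_attached_boundary[OF G _ _ weak B])
      show "degree_of G v \<le> M" if "v \<in> pverts G" for v using deg[OF that] by (auto simp: M_def)
      show "6 * k \<le> M" using ab by (simp add: M_def)
    qed
    then have "real (arcs_between G A (pverts G - A) + arcs_between G A B) < 6 * real k + 2 * real M"
      by (metis (mono_tags) of_nat_add of_nat_less_iff of_nat_mult of_nat_numeral)
    then have "sqrt (real (a * b)) * real (arcs_between G A (pverts G - A) + arcs_between G A B)
      < sqrt (real (a * b)) * (6 * real k + 2 * real M)"
      using ab0 by (intro mult_strict_left_mono) auto
    then show ?thesis using vol[OF weak] by simp
  qed
  show ?thesis
  proof (rule edge_disjoint_two_connected_of_weakly_attached[OF G k])
    show "4 * k \<le> degree_of G v" if "v \<in> pverts G" for v using deg[OF that] ab by auto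
    show "3 \<le> card (pverts G)"
    proof -
      obtain x where x: "x \<in> X" using V(1) by blast
      have "{u. (x, u) \<in> parcs G} \<subseteq> pverts G" using in_arcsD2 by auto
      then have "a \<le> card (pverts G)"
        using degX[OF x] card_mono[of "pverts G" "{u. (x, u) \<in> parcs G}"] by (simp add: degree_of_eq_card)
      then show ?thesis using ab k by simp
    qed
    fix W A W' A'
    assume weak: "weakly_attached G k W A" "weakly_attached G k W' A'"
      and disj: "A \<inter> W' = {}" "A' \<inter> W = {}"
    have A: "A \<subseteq> pverts G" "A \<noteq> {}" "A' \<subseteq> pverts G" "A' \<noteq> {}" "A' \<subseteq> W'"
      using weak by (auto simp: weakly_attached_def)
    have pos: "degree_of G v > 0" if "v \<in> pverts G" for v using deg[OF that] ab0 by auto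
    have AA': "A \<inter> A' = {}" using disj A by blast
    have "A' \<subseteq> pverts G - W" "A \<subseteq> pverts G - W'" using disj A by auto
    then show False
      using large_boundary_of_disjoint_sets[OF G pos prod A(1-4) AA']
        small[OF weak(1), of A'] small[OF weak(2), of A] arcs_between_commute[OF G, of A A']
      by (force simp: \<gamma>_def)
  qed
qed

end
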